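(* Let $N\ge 2$, $L=D^N-t_1(z)D^{N-1}+\dots+(-1)^{N-1}t_{N-1}(z)D+(-1)^Nt_N(z)$, and for $n\geq 1$ let $\partial_{\tau_n}$ be the derivation of $\mathcal R_{q,N}$ defined by $\partial_{\tau_n}L=[L,(L^{n/N})_+]$. Then: (1) the derivations $\partial_{\tau_n}$ are non-trivial for all $n$ not divisible by $N$, and all the $\partial_{\tau_n}$ commute with each other; (2) the functionals $\int\operatorname{Res}L^{n/N}$ are conserved with respect to all $\partial_{\tau_m}$, i.e. $\partial_{\tau_m}\cdot\int\operatorname{Res}L^{n/N}=0$ for all $n,m\ge1$; (3) $\int\operatorname{Res}L^{n/N}\ne0$ if $n$ is not divisible by $N$.
   Context: $q\in\mathbb C^\times$ is generic (in particular not a root of unity), and $D$ is the $q$-shift $[D\cdot f](z)=f(zq)$, so $D\,f(z)=f(zq)\,D$ as operators. The $t_i(z)=\sum_{m\in\mathbb Z}t_i[m]z^{-m}$, $i=1,\dots,N$, are formal Laurent series with independent coefficients $t_i[m]$. Ring $\mathcal R_{q,N}$: start with $\mathcal R^{(0)}_{q,N}=\mathbb C[t_i(zq^j)]_{1\le i\le N,\,j\in\mathbb Z}$, on which $D$ acts. $\mathcal R_{q,N}$ is the smallest ring with $D$-action containing it on which $1+D+\dots+D^{N-1}$ is invertible (obtained by iteratively adjoining the solutions $f$ of $(1+D+\dots+D^{N-1})f=R$). Fourier coefficients of elements $R(z)=\sum_mR[m]z^{-m}$ are linear combinations of series $\sum_{m_1+\dots+m_k=M}c(m_1,\dots,m_k)t_{i_1}[m_1]\cdots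 t_{i_k}[m_k]$ with $c$ rational in the $q^{m_i}$ without poles at integers. $\int R:=R[0]$, and $\mathcal L_{q,N}$ is the span of all $\int R$, $R\in\mathcal R_{q,N}$. $\mathcal P_{q,N}$ is the ring of operators $\sum_{n\le M}R_n(z)D^n$, $R_n\in\mathcal R_{q,N}$ (infinitely many negative powers allowed). For $R=\sum R_nD^n$: $R_+=\sum_{n\ge0}R_nD^n$, $R_-=\sum_{n<0}R_nD^n$, $\operatorname{Res}R=R_0$. $P\in\mathcal P_{q,N}$ is the unique element of the form $D+\sum_{m\ge0}p_mD^{-m}$ with $P^N=L$, and $L^{n/N}:=P^n$. The equation $\partial_{\tau_n}L=[L,(L^{n/N})_+]=-[L,(L^{n/N})_-]$, read coefficientwise, defines $\partial_{\tau_n}t_i$ for $i=1,\dots,N$ (its right side has only powers $D^1,\dots,D^{N-1}$); $\partial_{\tau_n}$ is extended to the derivation of $\mathcal R_{q,N}$ commuting with $D$, and acts on $\mathcal L_{q,N}$ by $\partial_{\tau_n}\int R=\int\partial_{\tau_n}R$. *)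

theory Defs
  imports Complex_Main "HOL-Library.Multiset"
begin

section \<open>Series in the coefficients of the formal Laurent series\<close>

text \<open>
  The pair \<open>(i, m)\<close> stands for the indeterminate \<open>t\<^sub>i[m]\<close>, a multiset of such pairs for
  a monomial, and an element of the type below for an arbitrary (infinite) formal sum of monomials
  with complex coefficients. Every monomial has only finitely many factorizations, so these sums
  form a commutative ring.

  For a Laurent series \<open>R(z) = \<Sum>\<^sub>m R[m] z\<^sup>-\<^sup>m\<close> of the kind considered here, all monomials
  occurring in \<open>R[m]\<close> have weight \<open>m\<close> (the weight of \<open>t\<^sub>i[m]\<close> being \<open>m\<close>). Hence the power
  of \<open>z\<close> can be read off from the monomial, and \<open>R(z)\<close> is encoded by the formal sum of all its
  Fourier coefficients: \<open>R[m]\<close> is recovered as the part of weight \<open>m\<close>, and the product of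
  Laurent series becomes the product of formal sums.
\<close>

typedef tseries = "UNIV :: ((nat \<times> int) multiset \<Rightarrow> complex) set"
  morphisms coeff Abs_tseries ..

lemma coeff_Abs [simp]: "coeff (Abs_tseries f) \<mu> = f \<mu>"
  by (simp add: Abs_tseries_inverse)

lemma tseries_eqI: "(\<And>\<mu>. coeff f \<mu> = coeff g \<mu>) \<Longrightarrow> f = g"
  by (metis coeff_inject ext)

definition splits :: "'a multiset \<Rightarrow> ('a multiset \<times> 'a multiset) set" where
  "splits \<mu> = {(\<alpha>, \<beta>). \<alpha> + \<beta> = \<mu>}"

lemma finite_splits [simp]: "finite (splits \<mu>)"
proof (induction \<mu>)
  case empty
  have "splits ({#} :: 'a multiset) = {({#}, {#})}" by (auto simp: splits_def)
  then show ?case by simp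
next
  case (add x \<mu>)
  let ?S = "splits \<mu>"
  have "splits (add_mset x \<mu>) \<subseteq>
      (\<lambda>(\<alpha>, \<beta>). (add_mset x \<alpha>, \<beta>)) ` ?S \<union> (\<lambda>(\<alpha>, \<beta>). (\<alpha>, add_mset x \<beta>)) ` ?S"
  proof
    fix p assume "p \<in> splits (add_mset x \<mu>)"
    then obtain \<alpha> \<beta> where p: "p = (\<alpha>, \<beta>)" and s: "\<alpha> + \<beta> = add_mset x \<mu>"
      by (auto simp: splits_def)
    have "x \<in># \<alpha> + \<beta>" by (simp add: s)
    then consider "x \<in># \<alpha>" | "x \<in># \<beta>" by auto
    then show "p \<in> (\<lambda>(\<alpha>, \<beta>). (add_mset x \<alpha>, \<beta>)) ` ?S \<union> (\<lambda>(\<alpha>, \<beta>). (\<alpha>, add_mset x \<beta>)) ` ?S"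
    proof cases
      case 1
      then obtain \<alpha>' where a: "\<alpha> = add_mset x \<alpha>'" by (metis mset_add)
      then have "(\<alpha>', \<beta>) \<in> ?S" using s by (simp add: splits_def)
      then show ?thesis using p a by force
    next
      case 2
      then obtain \<beta>' where b: "\<beta> = add_mset x \<beta>'" by (metis mset_add)
      then have "(\<alpha>, \<beta>') \<in> ?S" using s by (simp add: splits_def)
      then show ?thesis using p b by force
    qed
  qed
  then show ?case using add.IH by (meson finite_UnI finite_imageI finite_subset)
qed

instantiation tseries :: comm_ring_1
begin

definition zero_tseries :: tseries where
  "0 = Abs_tseries (\<lambda>_. 0)"

definition one_tseries :: tseries where
  "1 = Abs_tseries (\<lambda>\<mu>. if \<mu> = {#} then 1 else 0)"

definition plus_tseries :: "tseries \<Rightarrow> tseries \<Rightarrow> tseries" where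
  "f + g = Abs_tseries (\<lambda>\<mu>. coeff f \<mu> + coeff g \<mu>)"

definition uminus_tseries :: "tseries \<Rightarrow> tseries" where
  "- f = Abs_tseries (\<lambda>\<mu>. - coeff f \<mu>)"

definition minus_tseries :: "tseries \<Rightarrow> tseries \<Rightarrow> tseries" where
  "f - g = Abs_tseries (\<lambda>\<mu>. coeff f \<mu> - coeff g \<mu>)"

definition times_tseries :: "tseries \<Rightarrow> tseries \<Rightarrow> tseries" where
  "f * g = Abs_tseries (\<lambda>\<mu>. \<Sum>(\<alpha>, \<beta>) \<in> splits \<mu>. coeff f \<alpha> * coeff g \<beta>)"

instance
proof
  fix f g h :: tseries
  show "f * g * h = f * (g * h)"
  proof (rule tseries_eqI)
    fix \<mu> :: "(nat \<times> int) multiset"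
    let ?A = "SIGMA p : splits \<mu>. splits (fst p)"
    let ?B = "SIGMA p : splits \<mu>. splits (snd p)"
    have "coeff (f * g * h) \<mu> = (\<Sum>p \<in> splits \<mu>. \<Sum>r \<in> splits (fst p).
        coeff f (fst r) * coeff g (snd r) * coeff h (snd p))"
      by (simp add: times_tseries_def case_prod_unfold sum_distrib_right)
    also have "\<dots> = (\<Sum>(p, r) \<in> ?A. coeff f (fst r) * coeff g (snd r) * coeff h (snd p))"
      by (simp add: sum.Sigma)
    also have "\<dots> = (\<Sum>(p, r) \<in> ?B. coeff f (fst p) * (coeff g (fst r) * coeff h (snd r)))"
      by (rule sum.reindex_bij_witness
          [where j = "\<lambda>((ab, c), (a, b)). ((a, b + c), (b, c))"
             and i = "\<lambda>((a, bc), (b, c)). ((a + b, c), (a, b))"])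
        (auto simp: splits_def add.assoc mult.assoc)
    also have "\<dots> = (\<Sum>p \<in> splits \<mu>. \<Sum>r \<in> splits (snd p).
        coeff f (fst p) * (coeff g (fst r) * coeff h (snd r)))"
      by (simp add: sum.Sigma)
    also have "\<dots> = coeff (f * (g * h)) \<mu>"
      by (simp add: times_tseries_def case_prod_unfold sum_distrib_left)
    finally show "coeff (f * g * h) \<mu> = coeff (f * (g * h)) \<mu>" .
  qed
  show "f * g = g * f"
  proof (rule tseries_eqI)
    fix \<mu>
    have "(\<Sum>(\<alpha>, \<beta>) \<in> splits \<mu>. coeff f \<alpha> * coeff g \<beta>)
        = (\<Sum>(\<alpha>, \<beta>) \<in> splits \<mu>. coeff g \<alpha> * coeff f \<beta>)"
      by (rule sum.reindex_bij_witness[where i = prod.swap and j = prod.swap])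
        (auto simp: splits_def add.commute mult.commute)
    then show "coeff (f * g) \<mu> = coeff (g * f) \<mu>" by (simp add: times_tseries_def)
  qed
  show "1 * f = f"
  proof (rule tseries_eqI)
    fix \<mu>
    have "coeff (1 * f) \<mu>
        = (\<Sum>p \<in> splits \<mu>. if p = ({#}, \<mu>) then coeff f \<mu> else 0)"
      unfolding times_tseries_def one_tseries_def coeff_Abs
      by (rule sum.cong) (auto simp: splits_def split: if_splits)
    also have "\<dots> = coeff f \<mu>" by (simp add: splits_def sum.delta[OF finite_splits, unfolded splits_def])
    finally show "coeff (1 * f) \<mu> = coeff f \<mu>" .
  qed
  show "(f + g) * h = f * h + g * h"
    by (rule tseries_eqI)
      (simp add: times_tseries_def plus_tseries_def case_prod_unfold distrib_right sum.distrib)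
  show "f + g + h = f + (g + h)" "f + g = g + f" "0 + f = f" "- f + f = 0" "f - g = f + - g"
    by (rule tseries_eqI; simp add: plus_tseries_def zero_tseries_def uminus_tseries_def
        minus_tseries_def)+
  have "coeff 0 {#} \<noteq> coeff 1 {#}" by (simp add: zero_tseries_def one_tseries_def)
  then show "(0 :: tseries) \<noteq> 1" by metis
qed

end

definition const :: "complex \<Rightarrow> tseries" where
  "const c = Abs_tseries (\<lambda>\<mu>. if \<mu> = {#} then c else 0)"

definition weight :: "(nat \<times> int) multiset \<Rightarrow> int" where
  "weight \<mu> = (\<Sum>x \<in># \<mu>. snd x)"

definition fourier :: "tseries \<Rightarrow> int \<Rightarrow> tseries" where
  "fourier R m = Abs_tseries (\<lambda>\<mu>. if weight \<mu> = m then coeff R \<mu> else 0)"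

text \<open>The functional \<open>\<integral>R = R[0]\<close>.\<close>

definition integ :: "tseries \<Rightarrow> tseries" where
  "integ R = fourier R 0"

text \<open>The series \<open>t\<^sub>i(z) = \<Sum>\<^sub>m t\<^sub>i[m] z\<^sup>-\<^sup>m\<close>.\<close>

definition tgen :: "nat \<Rightarrow> tseries" where
  "tgen i = Abs_tseries (\<lambda>\<mu>. if \<exists>m. \<mu> = {#(i, m)#} then 1 else 0)"

text \<open>The operator \<open>D\<^sup>k\<close>, \<open>f(z) \<mapsto> f(z q\<^sup>k)\<close>; it multiplies the term \<open>R[m] z\<^sup>-\<^sup>m\<close> by \<open>q\<^sup>-\<^sup>k\<^sup>m\<close>.\<close>

definition shift :: "complex \<Rightarrow> int \<Rightarrow> tseries \<Rightarrow> tseries" where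
  "shift q k f = Abs_tseries (\<lambda>\<mu>. q powi (- k * weight \<mu>) * coeff f \<mu>)"

section \<open>The ring of coefficients\<close>

text \<open>\<open>1 + D + \<dots> + D\<^sup>N\<^sup>-\<^sup>1\<close>\<close>

definition cyc :: "complex \<Rightarrow> nat \<Rightarrow> tseries \<Rightarrow> tseries" where
  "cyc q N f = (\<Sum>k<N. shift q (int k) f)"

text \<open>The polynomial ring \<open>\<complex>[t\<^sub>i(zq\<^sup>j)]\<close>.\<close>

inductive_set R0 :: "complex \<Rightarrow> nat \<Rightarrow> tseries set" for q :: complex and N :: nat where
  const: "const c \<in> R0 q N"
| gen: "1 \<le> i \<Longrightarrow> i \<le> N \<Longrightarrow> shift q j (tgen i) \<in> R0 q N"
| add: "f \<in> R0 q N \<Longrightarrow> g \<in> R0 q N \<Longrightarrow> f + g \<in> R0 q N"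
| mult: "f \<in> R0 q N \<Longrightarrow> g \<in> R0 q N \<Longrightarrow> f * g \<in> R0 q N"

text \<open>The ring obtained by iteratively adjoining the solutions \<open>f\<close> of
  \<open>(1 + D + \<dots> + D\<^sup>N\<^sup>-\<^sup>1) f = R\<close>. It is a complex algebra because it contains \<open>const c\<close>.\<close>

inductive_set Rq :: "complex \<Rightarrow> nat \<Rightarrow> tseries set" for q :: complex and N :: nat where
  base: "f \<in> R0 q N \<Longrightarrow> f \<in> Rq q N"
| add: "f \<in> Rq q N \<Longrightarrow> g \<in> Rq q N \<Longrightarrow> f + g \<in> Rq q N"
| mult: "f \<in> Rq q N \<Longrightarrow> g \<in> Rq q N \<Longrightarrow> f * g \<in> Rq q N"
| shift: "f \<in> Rq q N \<Longrightarrow> shift q j f \<in> Rq q N"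
| solve: "cyc q N f \<in> Rq q N \<Longrightarrow> f \<in> Rq q N"

text \<open>The next lemmas confirm that this is the smallest ring with \<open>D\<close>-action that contains
  \<open>R0\<close> and on which \<open>1 + D + \<dots> + D\<^sup>N\<^sup>-\<^sup>1\<close> is invertible.\<close>

definition difference_ring :: "complex \<Rightarrow> tseries set \<Rightarrow> bool" where
  "difference_ring q S \<longleftrightarrow> 1 \<in> S \<and> (\<forall>f\<in>S. \<forall>g\<in>S. f - g \<in> S \<and> f * g \<in> S) \<and>
     (\<forall>f\<in>S. \<forall>j. shift q j f \<in> S)"

lemma coeff_sum: "coeff (sum F A) \<mu> = (\<Sum>a\<in>A. coeff (F a) \<mu>)"
  by (induction A rule: infinite_finite_induct) (auto simp: zero_tseries_def plus_tseries_def)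

definition cyc_eigenvalue :: "complex \<Rightarrow> nat \<Rightarrow> int \<Rightarrow> complex" where
  "cyc_eigenvalue q N m = (\<Sum>k<N. q powi (- int k * m))"

lemma coeff_cyc: "coeff (cyc q N f) \<mu> = cyc_eigenvalue q N (weight \<mu>) * coeff f \<mu>"
  by (simp add: cyc_def coeff_sum shift_def cyc_eigenvalue_def sum_distrib_right)

lemma powi_ne_1:
  fixes q :: complex
  assumes q0: "q \<noteq> 0" and q: "\<forall>k\<ge>1. q ^ k \<noteq> 1" and "m \<noteq> 0"
  shows "q powi m \<noteq> 1"
proof (cases "m > 0")
  case True
  then show ?thesis using q by (auto simp: power_int_def)
next
  case False
  with \<open>m \<noteq> 0\<close> have "q ^ nat (- m) \<noteq> 1" using q by auto
  then show ?thesis using False \<open>m \<noteq> 0\<close> by (auto simp: power_int_def field_simps)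
qed

lemma cyc_eigenvalue_ne_0:
  assumes q0: "q \<noteq> 0" and q: "\<forall>k\<ge>1. q ^ k \<noteq> 1" and N: "N \<ge> 1"
  shows "cyc_eigenvalue q N m \<noteq> 0"
proof (cases "m = 0")
  case True
  then show ?thesis using N by (simp add: cyc_eigenvalue_def)
next
  case False
  let ?x = "q powi (- m)"
  have pw: "q powi (- int k * m) = ?x ^ k" for k
    by (simp add: power_int_power' mult.commute)
  have "(1 - ?x) * cyc_eigenvalue q N m = 1 - ?x ^ N"
    unfolding cyc_eigenvalue_def pw by (rule one_diff_power_eq[symmetric])
  moreover have "?x ^ N \<noteq> 1"
    unfolding pw[symmetric] using powi_ne_1[OF q0 q, of "- int N * m"] False N by simp
  ultimately show ?thesis by auto
qed

lemma Rq_const: "const c \<in> Rq q N"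
  by (intro Rq.base R0.const)

lemma one_eq_const: "1 = const 1"
  by (simp add: one_tseries_def const_def)

lemma uminus_eq_const: "- f = const (- 1) * f"
proof -
  have "const (- 1) = - 1"
    by (rule tseries_eqI) (simp add: const_def one_tseries_def uminus_tseries_def)
  then show ?thesis by simp
qed

lemma Rq_diff: "f \<in> Rq q N \<Longrightarrow> g \<in> Rq q N \<Longrightarrow> f - g \<in> Rq q N"
  using Rq.add[of f q N "- g"] Rq.mult[OF Rq_const, of g q N "- 1"]
  by (simp add: uminus_eq_const[of g, symmetric])

lemma Rq_cyc: "f \<in> Rq q N \<Longrightarrow> cyc q N f \<in> Rq q N"
proof -
  assume f: "f \<in> Rq q N"
  have "(\<Sum>k\<in>A. shift q (int k) f) \<in> Rq q N" if "finite A" for A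
    using that
  proof induction
    case empty
    show ?case using Rq_diff[OF f f] by simp
  next
    case (insert k A)
    then show ?case by (simp add: Rq.add Rq.shift f)
  qed
  then show ?thesis by (simp add: cyc_def)
qed

lemma cyc_inj:
  assumes "q \<noteq> 0" "\<forall>k\<ge>1. q ^ k \<noteq> 1" "N \<ge> 1" "cyc q N f = cyc q N g"
  shows "f = g"
proof (rule tseries_eqI)
  fix \<mu>
  have "coeff (cyc q N f) \<mu> = coeff (cyc q N g) \<mu>" using assms(4) by simp
  then show "coeff f \<mu> = coeff g \<mu>"
    using cyc_eigenvalue_ne_0[OF assms(1-3)] by (simp add: coeff_cyc)
qed

lemma cyc_surj:
  assumes "q \<noteq> 0" "\<forall>k\<ge>1. q ^ k \<noteq> 1" "N \<ge> 1"
  shows "\<exists>f. cyc q N f = g"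
proof
  show "cyc q N (Abs_tseries (\<lambda>\<mu>. coeff g \<mu> / cyc_eigenvalue q N (weight \<mu>))) = g"
    by (rule tseries_eqI) (simp add: coeff_cyc cyc_eigenvalue_ne_0[OF assms])
qed

lemma difference_ring_Rq:
  assumes "q \<noteq> 0" "\<forall>k\<ge>1. q ^ k \<noteq> 1" "N \<ge> 1"
  shows "difference_ring q (Rq q N)" "R0 q N \<subseteq> Rq q N" "bij_betw (cyc q N) (Rq q N) (Rq q N)"
proof -
  show "difference_ring q (Rq q N)"
    unfolding difference_ring_def by (auto simp: one_eq_const Rq_const Rq_diff Rq.mult Rq.shift)
  show "R0 q N \<subseteq> Rq q N" by (auto intro: Rq.base)
  have "inj_on (cyc q N) (Rq q N)" using cyc_inj[OF assms] by (auto simp: inj_on_def)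
  moreover have "cyc q N ` Rq q N = Rq q N"
  proof
    show "cyc q N ` Rq q N \<subseteq> Rq q N" by (auto intro: Rq_cyc)
    show "Rq q N \<subseteq> cyc q N ` Rq q N"
    proof
      fix g assume g: "g \<in> Rq q N"
      obtain f where f: "cyc q N f = g" using cyc_surj[OF assms] by blast
      with g have "f \<in> Rq q N" by (auto intro: Rq.solve)
      with f show "g \<in> cyc q N ` Rq q N" by auto
    qed
  qed
  ultimately show "bij_betw (cyc q N) (Rq q N) (Rq q N)" by (simp add: bij_betw_def)
qed

lemma Rq_least:
  assumes "q \<noteq> 0" "\<forall>k\<ge>1. q ^ k \<noteq> 1" "N \<ge> 1"
    and S: "difference_ring q S" "R0 q N \<subseteq> S" "bij_betw (cyc q N) S S"
  shows "Rq q N \<subseteq> S"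
proof
  fix f assume "f \<in> Rq q N"
  then show "f \<in> S"
  proof induction
    case (add f g)
    have "(1 :: tseries) - 1 \<in> S" using S(1) unfolding difference_ring_def by blast
    then have "0 - g \<in> S" using S(1) add.IH unfolding difference_ring_def by fastforce
    then have "f - (0 - g) \<in> S" using S(1) add.IH unfolding difference_ring_def by blast
    then show ?case by simp
  next
    case (solve f)
    then obtain g where "g \<in> S" "cyc q N g = cyc q N f"
      using S(3) unfolding bij_betw_def by (metis imageE)
    then show ?case using cyc_inj[OF assms(1-3)] by metis
  qed (use S in \<open>auto simp: difference_ring_def\<close>)
qed

section \<open>Difference operators\<close>

text \<open>The function \<open>A\<close> stands for the operator \<open>\<Sum>\<^sub>n A\<^sub>n D\<^sup>n\<close>.\<close>

type_synonym qop = "int \<Rightarrow> tseries"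

definition pdo :: "complex \<Rightarrow> nat \<Rightarrow> qop set" where
  "pdo q N = {A. (\<forall>n. A n \<in> Rq q N) \<and> (\<exists>M. \<forall>n>M. A n = 0)}"

text \<open>The rule \<open>D\<^sup>k f(z) = f(z q\<^sup>k) D\<^sup>k\<close> gives \<open>(AB)\<^sub>n = \<Sum>\<^sub>k A\<^sub>k D\<^sup>k(B\<^sub>n\<^sub>-\<^sub>k)\<close>. If the orders of
  \<open>A\<close> and \<open>B\<close> are bounded above, the index set below is finite.\<close>

definition op_mult :: "complex \<Rightarrow> qop \<Rightarrow> qop \<Rightarrow> qop" where
  "op_mult q A B = (\<lambda>n. \<Sum>k | A k \<noteq> 0 \<and> B (n - k) \<noteq> 0. A k * shift q k (B (n - k)))"

definition op_one :: qop where
  "op_one = (\<lambda>n. if n = 0 then 1 else 0)"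

primrec op_pow :: "complex \<Rightarrow> qop \<Rightarrow> nat \<Rightarrow> qop" where
  "op_pow q A 0 = op_one"
| "op_pow q A (Suc n) = op_mult q A (op_pow q A n)"

definition op_comm :: "complex \<Rightarrow> qop \<Rightarrow> qop \<Rightarrow> qop" where
  "op_comm q A B = (\<lambda>n. op_mult q A B n - op_mult q B A n)"

definition op_plus_part :: "qop \<Rightarrow> qop" where
  "op_plus_part A = (\<lambda>n. if n \<ge> 0 then A n else 0)"

definition op_Res :: "qop \<Rightarrow> tseries" where
  "op_Res A = A 0"

text \<open>\<open>L = D\<^sup>N - t\<^sub>1(z) D\<^sup>N\<^sup>-\<^sup>1 + \<dots> + (-1)\<^sup>N t\<^sub>N(z)\<close>\<close>

definition lax :: "nat \<Rightarrow> qop" where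
  "lax N = (\<lambda>n. if n = int N then 1
     else if 0 \<le> n \<and> n < int N then (- 1) ^ (N - nat n) * tgen (N - nat n)
     else 0)"

text \<open>\<open>P = D + \<Sum>\<^sub>m\<^sub>\<ge>\<^sub>0 p\<^sub>m D\<^sup>-\<^sup>m\<close> with \<open>P\<^sup>N = L\<close>, and \<open>L\<^sup>n\<^sup>/\<^sup>N = P\<^sup>n\<close>.\<close>

definition is_lax_root :: "complex \<Rightarrow> nat \<Rightarrow> qop \<Rightarrow> bool" where
  "is_lax_root q N P \<longleftrightarrow>
     P \<in> pdo q N \<and> P 1 = 1 \<and> (\<forall>n>1. P n = 0) \<and> op_pow q P N = lax N"

definition lax_root :: "complex \<Rightarrow> nat \<Rightarrow> qop" where
  "lax_root q N = (THE P. is_lax_root q N P)"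

definition lax_frac_pow :: "complex \<Rightarrow> nat \<Rightarrow> nat \<Rightarrow> qop" where
  "lax_frac_pow q N n = op_pow q (lax_root q N) n"

section \<open>The flows\<close>

text \<open>Derivations of the complex algebra \<open>Rq q N\<close> commuting with \<open>D\<close>. The last clause fixes the
  irrelevant values outside the ring, so that such a derivation is a unique HOL function.\<close>

definition difference_derivation :: "complex \<Rightarrow> nat \<Rightarrow> (tseries \<Rightarrow> tseries) \<Rightarrow> bool" where
  "difference_derivation q N d \<longleftrightarrow>
     (\<forall>f \<in> Rq q N. d f \<in> Rq q N) \<and>
     (\<forall>f \<in> Rq q N. \<forall>g \<in> Rq q N. d (f + g) = d f + d g) \<and>
     (\<forall>f \<in> Rq q N. \<forall>g \<in> Rq q N. d (f * g) = d f * g + f * d g) \<and>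
     (\<forall>c. d (const c) = 0) \<and>
     (\<forall>f \<in> Rq q N. d (shift q 1 f) = shift q 1 (d f)) \<and>
     (\<forall>f. f \<notin> Rq q N \<longrightarrow> d f = 0)"

text \<open>The Lax equation \<open>\<partial>L = [L, (L\<^sup>n\<^sup>/\<^sup>N)\<^sub>+]\<close>, read coefficientwise.\<close>

definition is_flow :: "complex \<Rightarrow> nat \<Rightarrow> nat \<Rightarrow> (tseries \<Rightarrow> tseries) \<Rightarrow> bool" where
  "is_flow q N n d \<longleftrightarrow> difference_derivation q N d \<and>
     (\<forall>k. d (lax N k) = op_comm q (lax N) (op_plus_part (lax_frac_pow q N n)) k)"

definition flow :: "complex \<Rightarrow> nat \<Rightarrow> nat \<Rightarrow> tseries \<Rightarrow> tseries" where
  "flow q N n = (THE d. is_flow q N n d)"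

text \<open>The space of functionals, spanned by all \<open>\<integral>R\<close>; since \<open>\<integral>\<close> is linear and \<open>Rq q N\<close> is a
  complex vector space, the image of \<open>\<integral>\<close> is already its own span.\<close>

definition functionals :: "complex \<Rightarrow> nat \<Rightarrow> tseries set" where
  "functionals q N = integ ` Rq q N"

lemma functionals_subspace:
  assumes "F \<in> functionals q N" "G \<in> functionals q N"
  shows "F + G \<in> functionals q N" "const c * F \<in> functionals q N"
proof -
  obtain R S where R: "R \<in> Rq q N" "F = integ R" and S: "S \<in> Rq q N" "G = integ S"
    using assms by (auto simp: functionals_def)
  have "F + G = integ (R + S)"
    by (rule tseries_eqI) (simp add: R S integ_def fourier_def plus_tseries_def)
  then show "F + G \<in> functionals q N" using R S by (auto simp: functionals_def intro: Rq.add)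
  have smult: "coeff (const c * f) \<mu> = c * coeff f \<mu>" for f \<mu>
  proof -
    have "coeff (const c * f) \<mu>
        = (\<Sum>p \<in> splits \<mu>. if p = ({#}, \<mu>) then c * coeff f \<mu> else 0)"
      unfolding times_tseries_def const_def coeff_Abs
      by (rule sum.cong) (auto simp: splits_def split: if_splits)
    also have "\<dots> = c * coeff f \<mu>"
      by (simp add: splits_def sum.delta[OF finite_splits, unfolded splits_def])
    finally show ?thesis .
  qed
  have "const c * F = integ (const c * R)"
    by (rule tseries_eqI) (simp add: R smult, simp add: integ_def fourier_def smult)
  then show "const c * F \<in> functionals q N"
    using R by (auto simp: functionals_def intro: Rq.mult Rq_const)
qed

text \<open>The action \<open>\<partial>(\<integral>R) = \<integral>(\<partial>R)\<close> of a derivation on functionals.\<close>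

definition act :: "complex \<Rightarrow> nat \<Rightarrow> (tseries \<Rightarrow> tseries) \<Rightarrow> tseries \<Rightarrow> tseries" where
  "act q N d F = (THE G. \<exists>R \<in> Rq q N. integ R = F \<and> G = integ (d R))"

end

theory Submission
  imports Defs "HOL-Library.Function_Algebras" "HOL-Computational_Algebra.Formal_Power_Series"
begin

text \<open>
  A flow is the restriction to the ring of an evolutionary derivation
  \<open>\<Sum>\<^sub>i\<^sub>,\<^sub>m R\<^sub>i[m] \<partial>/\<partial>t\<^sub>i[m]\<close>, which makes sense on all series and preserves the weight; so it
  commutes with \<open>D\<close>, with the inverse of \<open>1 + D + \<dots> + D\<^sup>N\<^sup>-\<^sup>1\<close> and with \<open>\<integral>\<close>. The leading term of
  \<open>X \<mapsto> \<Sum>\<^sub>k P\<^sup>k X P\<^sup>N\<^sup>-\<^sup>1\<^sup>-\<^sup>k\<close> is governed by \<open>1 + D + \<dots> + D\<^sup>N\<^sup>-\<^sup>1\<close>, hence this map is injective;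
  this yields the \<open>N\<close>-th root of \<open>L\<close> and the equation \<open>\<partial>P = [P, (P\<^sup>n)\<^sub>+]\<close>. Commutativity of the flows is then
  the zero-curvature equation, and conservation holds because \<open>\<integral>Res\<close> vanishes on commutators.

  For the nonvanishing, all variables but one \<open>t\<^sub>i[0]\<close> are set to zero, so that everything commutes and
  \<open>P\<^sup>n = (D\<^sup>N \<plusminus> t\<^sub>i[0] D\<^sup>N\<^sup>-\<^sup>i)\<^sup>n\<^sup>/\<^sup>N\<close> is a binomial series. With \<open>i = 1\<close> the residue contains
  \<open>t\<^sub>1[0]\<^sup>n\<close>. With \<open>i = N\<close> and \<open>n = N a + b\<close>, \<open>0 < b < N\<close>, the coefficient of \<open>D\<^sup>b\<close> in
  \<open>[L, (P\<^sup>n)\<^sub>+]\<close> contains \<open>t\<^sub>N[0]\<^sup>a t\<^sub>N[1]\<close>.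
\<close>

unbundle fps_syntax

section \<open>Series\<close>

lemma coeff_zero [simp]: "coeff 0 \<mu> = 0"
  and coeff_one: "coeff 1 \<mu> = (if \<mu> = {#} then 1 else 0)"
  and coeff_plus [simp]: "coeff (f + g) \<mu> = coeff f \<mu> + coeff g \<mu>"
  and coeff_minus [simp]: "coeff (f - g) \<mu> = coeff f \<mu> - coeff g \<mu>"
  and coeff_uminus [simp]: "coeff (- f) \<mu> = - coeff f \<mu>"
  and coeff_times: "coeff (f * g) \<mu> = (\<Sum>(\<alpha>, \<beta>) \<in> splits \<mu>. coeff f \<alpha> * coeff g \<beta>)"
  and coeff_const: "coeff (const c) \<mu> = (if \<mu> = {#} then c else 0)"
  and coeff_shift [simp]: "coeff (shift q k f) \<mu> = q powi (- k * weight \<mu>) * coeff f \<mu>"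
  and coeff_integ: "coeff (integ f) \<mu> = (if weight \<mu> = 0 then coeff f \<mu> else 0)"
  and coeff_tgen: "coeff (tgen i) \<mu> = (if \<exists>m. \<mu> = {#(i, m)#} then 1 else 0)"
  by (simp_all add: zero_tseries_def one_tseries_def plus_tseries_def minus_tseries_def
      uminus_tseries_def times_tseries_def const_def shift_def integ_def fourier_def tgen_def)

lemma weight_empty [simp]: "weight {#} = 0"
  and weight_add_mset [simp]: "weight (add_mset x \<mu>) = snd x + weight \<mu>"
  and weight_plus [simp]: "weight (\<alpha> + \<beta>) = weight \<alpha> + weight \<beta>"
  by (simp_all add: weight_def)

lemma splitsD: "p \<in> splits \<mu> \<Longrightarrow> fst p + snd p = \<mu>"
  by (auto simp: splits_def)

lemma shift_0 [simp]: "shift q 0 f = f"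
  and shift_zero [simp]: "shift q k 0 = 0"
  and shift_one [simp]: "shift q k 1 = 1"
  and shift_plus: "shift q k (f + g) = shift q k f + shift q k g"
  and shift_minus: "shift q k (f - g) = shift q k f - shift q k g"
  and shift_uminus: "shift q k (- f) = - shift q k f"
  by (rule tseries_eqI; simp add: coeff_one coeff_const ring_distribs)+

lemma shift_sum: "shift q k (sum f A) = (\<Sum>a\<in>A. shift q k (f a))"
  by (induction A rule: infinite_finite_induct) (auto simp: shift_plus)

lemma Rq_zero [simp]: "0 \<in> Rq q N"
  using Rq_diff[OF Rq_const[of 0 q N] Rq_const[of 0 q N]] by simp

lemma Rq_one [simp]: "1 \<in> Rq q N"
  by (simp add: one_eq_const Rq_const)

lemma Rq_uminus: "f \<in> Rq q N \<Longrightarrow> - f \<in> Rq q N"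
  using Rq_diff[of 0 q N f] by simp

lemma Rq_sum: "(\<And>a. a \<in> A \<Longrightarrow> f a \<in> Rq q N) \<Longrightarrow> sum f A \<in> Rq q N"
  by (induction A rule: infinite_finite_induct) (auto intro: Rq.add)

lemma Rq_tgen: "1 \<le> i \<Longrightarrow> i \<le> N \<Longrightarrow> tgen i \<in> Rq q N"
  using Rq.base[OF R0.gen[of i N q 0]] by simp

lemma minus_one_power_cases: "(-1 :: tseries) ^ k = 1 \<or> (-1 :: tseries) ^ k = -1"
  by (cases "even k") auto

locale qshift =
  fixes q :: complex
  assumes q_nz: "q \<noteq> 0"
begin

abbreviation \<sigma> :: "int \<Rightarrow> tseries \<Rightarrow> tseries" where "\<sigma> \<equiv> shift q"

text \<open>Weights add under factorization, so the factor
  \<open>q powi (- k * weight \<mu>)\<close> is multiplicative.\<close>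

lemma shift_mult: "\<sigma> k (f * g) = \<sigma> k f * \<sigma> k g"
proof (rule tseries_eqI)
  fix \<mu>
  show "coeff (\<sigma> k (f * g)) \<mu> = coeff (\<sigma> k f * \<sigma> k g) \<mu>"
    unfolding coeff_shift coeff_times sum_distrib_left
    by (rule sum.cong)
      (auto simp: splits_def power_int_add q_nz algebra_simps power_int_diff power_int_minus divide_simps)
qed

lemma shift_shift: "\<sigma> k (\<sigma> l f) = \<sigma> (k + l) f"
  by (rule tseries_eqI)
    (simp add: q_nz algebra_simps power_int_diff power_int_minus power_int_add divide_simps)

section \<open>Difference operators\<close>

abbreviation mult_op :: "qop \<Rightarrow> qop \<Rightarrow> qop" (infixl "\<star>" 70) where
  "A \<star> B \<equiv> op_mult q A B"

definition deg_le :: "qop \<Rightarrow> int \<Rightarrow> bool" where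
  "deg_le A d \<longleftrightarrow> (\<forall>n>d. A n = 0)"

text \<open>The coefficients are arbitrary series here; membership in \<open>Rq q N\<close> is
  tracked separately. The bound on the order makes products finite sums.\<close>

definition K :: "qop set" where
  "K = {A. \<exists>d. deg_le A d}"

lemma deg_leD: "deg_le A d \<Longrightarrow> n > d \<Longrightarrow> A n = 0"
  by (simp add: deg_le_def)

lemma deg_le_mono: "deg_le A d \<Longrightarrow> d \<le> e \<Longrightarrow> deg_le A e"
  by (auto simp: deg_le_def)

lemma deg_le_K: "deg_le A d \<Longrightarrow> A \<in> K"
  by (auto simp: K_def)

text \<open>Replaces the index set in \<open>op_mult\<close>, which varies with \<open>A\<close> and
  \<open>B\<close>, by any sufficiently large finite range, so that sums can be compared
  termwise.\<close>

lemma op_mult_eq_sum: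
  assumes "finite S" "\<And>k. A k \<noteq> 0 \<Longrightarrow> B (n - k) \<noteq> 0 \<Longrightarrow> k \<in> S"
  shows "(A \<star> B) n = (\<Sum>k\<in>S. A k * \<sigma> k (B (n - k)))"
  unfolding op_mult_def using assms by (intro sum.mono_neutral_left) auto

lemma op_mult_eq:
  assumes "deg_le A a" "deg_le B b" "a \<le> a'" "b \<le> b'"
  shows "(A \<star> B) n = (\<Sum>k\<in>{n - b'..a'}. A k * \<sigma> k (B (n - k)))"
  by (rule op_mult_eq_sum) (use assms in \<open>force simp: deg_le_def not_less[symmetric]\<close>)+

lemma deg_le_mult:
  assumes "deg_le A a" "deg_le B b"
  shows "deg_le (A \<star> B) (a + b)"
  unfolding deg_le_def using op_mult_eq[OF assms order_refl order_refl] by auto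

lemma top_coeff_mult:
  assumes "deg_le A a" "deg_le B b"
  shows "(A \<star> B) (a + b) = A a * \<sigma> a (B b)"
  using op_mult_eq[OF assms order_refl order_refl] by auto

lemma K_mult [simp]: "A \<in> K \<Longrightarrow> B \<in> K \<Longrightarrow> A \<star> B \<in> K"
  unfolding K_def using deg_le_mult by blast

lemma deg_le_add: "deg_le A a \<Longrightarrow> deg_le B a \<Longrightarrow> deg_le (A + B) a"
  and deg_le_diff: "deg_le A a \<Longrightarrow> deg_le B a \<Longrightarrow> deg_le (A - B) a"
  and deg_le_0 [simp]: "deg_le 0 a"
  by (auto simp: deg_le_def)

lemma K_common_bound:
  assumes "A \<in> K" "B \<in> K"
  obtains d where "deg_le A d" "deg_le B d"
proof -
  obtain a b where "deg_le A a" "deg_le B b" using assms by (auto simp: K_def)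
  then show ?thesis using that[of "max a b"] by (meson deg_le_mono max.cobounded1 max.cobounded2)
qed

lemma K_add [simp]: "A \<in> K \<Longrightarrow> B \<in> K \<Longrightarrow> A + B \<in> K"
  and K_diff [simp]: "A \<in> K \<Longrightarrow> B \<in> K \<Longrightarrow> A - B \<in> K"
  by (metis K_common_bound deg_le_K deg_le_add, metis K_common_bound deg_le_K deg_le_diff)

lemma K_0 [simp]: "0 \<in> K"
  by (auto simp: K_def)

lemma op_mult_assoc:
  assumes "A \<in> K" "B \<in> K" "C \<in> K"
  shows "(A \<star> B) \<star> C = A \<star> (B \<star> C)"
proof
  fix n
  obtain a b c where abc: "deg_le A a" "deg_le B b" "deg_le C c"
    using assms by (auto simp: K_def)
  have "((A \<star> B) \<star> C) n = (\<Sum>j\<in>{n-c..a+b}. (A \<star> B) j * \<sigma> j (C (n - j)))"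
    by (rule op_mult_eq[OF deg_le_mult]) (use abc in auto)
  \<comment> \<open>The range of \<open>k\<close> is enlarged to one independent of
    \<open>j\<close>, so that the two sums can be swapped.\<close>
  also have "\<dots> = (\<Sum>j\<in>{n-c..a+b}. \<Sum>k\<in>{n-c-b..a}. A k * \<sigma> k (B (j - k)) * \<sigma> j (C (n - j)))"
  proof (rule sum.cong[OF refl])
    fix j assume "j \<in> {n-c..a+b}"
    then have "(A \<star> B) j = (\<Sum>k\<in>{n-c-b..a}. A k * \<sigma> k (B (j - k)))"
      using abc by (intro op_mult_eq_sum) (force simp: deg_le_def not_less[symmetric])+
    then show "(A \<star> B) j * \<sigma> j (C (n - j)) =
        (\<Sum>k\<in>{n-c-b..a}. A k * \<sigma> k (B (j - k)) * \<sigma> j (C (n - j)))"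
      by (simp add: sum_distrib_right)
  qed
  also have "\<dots> = (\<Sum>k\<in>{n-c-b..a}. \<Sum>j\<in>{n-c..a+b}. A k * \<sigma> k (B (j - k)) * \<sigma> j (C (n - j)))"
    by (rule sum.swap)
  also have "\<dots> = (\<Sum>k\<in>{n-c-b..a}. A k * \<sigma> k ((B \<star> C) (n - k)))"
  proof (rule sum.cong[OF refl])
    fix k assume k: "k \<in> {n-c-b..a}"
    have "(B \<star> C) (n - k) = (\<Sum>l\<in>{n-c-k..a+b-k}. B l * \<sigma> l (C (n - k - l)))"
      using abc k by (intro op_mult_eq_sum) (force simp: deg_le_def not_less[symmetric])+
    then have "A k * \<sigma> k ((B \<star> C) (n - k)) =
        (\<Sum>l\<in>{n-c-k..a+b-k}. A k * \<sigma> k (B l) * \<sigma> (k + l) (C (n - k - l)))"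
      by (simp add: shift_sum shift_mult shift_shift sum_distrib_left mult.assoc)
    also have "\<dots> = (\<Sum>j\<in>{n-c..a+b}. A k * \<sigma> k (B (j - k)) * \<sigma> j (C (n - j)))"
      by (rule sum.reindex_bij_witness[where i = "\<lambda>j. j - k" and j = "\<lambda>l. l + k"])
        (auto simp: algebra_simps)
    finally show "(\<Sum>j\<in>{n-c..a+b}. A k * \<sigma> k (B (j - k)) * \<sigma> j (C (n - j))) =
        A k * \<sigma> k ((B \<star> C) (n - k))" ..
  qed
  also have "\<dots> = (A \<star> (B \<star> C)) n"
    using op_mult_eq[OF abc(1) deg_le_mult[OF abc(2,3)] order_refl order_refl, of n]
    by (simp add: algebra_simps)
  finally show "((A \<star> B) \<star> C) n = (A \<star> (B \<star> C)) n" .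
qed

lemma
  assumes "A \<in> K" "B \<in> K" "C \<in> K"
  shows op_mult_add_left: "(A + B) \<star> C = A \<star> C + B \<star> C"
    and op_mult_add_right: "C \<star> (A + B) = C \<star> A + C \<star> B"
    and op_mult_diff_left: "(A - B) \<star> C = A \<star> C - B \<star> C"
    and op_mult_diff_right: "C \<star> (A - B) = C \<star> A - C \<star> B"
proof -
  obtain a where a: "deg_le A a" "deg_le B a" using assms K_common_bound by blast
  obtain c where c: "deg_le C c" using assms by (auto simp: K_def)
  note ab = op_mult_eq[OF _ c order_refl order_refl, of _ a]
    op_mult_eq[OF c _ order_refl order_refl, of _ a]
  show "(A + B) \<star> C = A \<star> C + B \<star> C" "C \<star> (A + B) = C \<star> A + C \<star> B"
    "(A - B) \<star> C = A \<star> C - B \<star> C" "C \<star> (A - B) = C \<star> A - C \<star> B"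
    by (rule ext, simp add: ab a deg_le_add deg_le_diff shift_plus shift_minus ring_distribs
        sum.distrib sum_subtractf)+
qed

lemma op_mult_0_left [simp]: "0 \<star> A = 0"
  and op_mult_0_right [simp]: "A \<star> 0 = 0"
  by (auto simp: op_mult_def)

lemma deg_le_one: "deg_le op_one 0"
  by (auto simp: deg_le_def op_one_def)

lemma K_one [simp]: "op_one \<in> K"
  using deg_le_one deg_le_K by blast

lemma op_mult_one_left [simp]: "op_one \<star> A = A"
proof
  fix n
  have "(op_one \<star> A) n = (\<Sum>k\<in>{0}. op_one k * \<sigma> k (A (n - k)))"
    by (rule op_mult_eq_sum) (auto simp: op_one_def split: if_splits)
  then show "(op_one \<star> A) n = A n" by (simp add: op_one_def)
qed

lemma op_mult_one_right [simp]: "A \<star> op_one = A"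
proof
  fix n
  have "(A \<star> op_one) n = (\<Sum>k\<in>{n}. A k * \<sigma> k (op_one (n - k)))"
    by (rule op_mult_eq_sum) (auto simp: op_one_def split: if_splits)
  then show "(A \<star> op_one) n = A n" by (simp add: op_one_def)
qed

lemma K_pow [simp]: "A \<in> K \<Longrightarrow> op_pow q A n \<in> K"
  by (induction n) auto

lemma op_pow_add: "A \<in> K \<Longrightarrow> op_pow q A (m + n) = op_pow q A m \<star> op_pow q A n"
  by (induction m) (auto simp: op_mult_assoc)

lemma op_pow_commute: "A \<in> K \<Longrightarrow> op_pow q A m \<star> op_pow q A n = op_pow q A n \<star> op_pow q A m"
  by (metis add.commute op_pow_add)

abbreviation comm_op :: "qop \<Rightarrow> qop \<Rightarrow> qop" ("\<lbrakk>_, _\<rbrakk>") where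
  "\<lbrakk>A, B\<rbrakk> \<equiv> op_comm q A B"

lemma op_comm_eq: "\<lbrakk>A, B\<rbrakk> = A \<star> B - B \<star> A"
  by (auto simp: op_comm_def)

lemmas op_ring_simps = op_comm_eq op_mult_assoc op_mult_add_left op_mult_add_right
  op_mult_diff_left op_mult_diff_right

lemma K_comm [simp]: "A \<in> K \<Longrightarrow> B \<in> K \<Longrightarrow> \<lbrakk>A, B\<rbrakk> \<in> K"
  by (simp add: op_comm_eq)

lemma op_comm_jacobi:
  assumes "A \<in> K" "B \<in> K" "C \<in> K"
  shows "\<lbrakk>\<lbrakk>A, B\<rbrakk>, C\<rbrakk> - \<lbrakk>\<lbrakk>A, C\<rbrakk>, B\<rbrakk> = \<lbrakk>A, \<lbrakk>B, C\<rbrakk>\<rbrakk>"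
  using assms by (simp add: op_ring_simps algebra_simps)

subsection \<open>Monic operators of degree one and their powers\<close>

definition monic1 :: "qop \<Rightarrow> bool" where
  "monic1 A \<longleftrightarrow> deg_le A 1 \<and> A 1 = 1"

lemma monic1_K [simp]: "monic1 A \<Longrightarrow> A \<in> K"
  by (auto simp: monic1_def deg_le_K)

lemma monic1_pow:
  assumes "monic1 A"
  shows "deg_le (op_pow q A n) (int n)" "op_pow q A n (int n) = 1"
proof -
  have "deg_le (op_pow q A n) (int n) \<and> op_pow q A n (int n) = 1"
  proof (induction n)
    case 0
    show ?case using deg_le_one by (simp add: op_one_def)
  next
    case (Suc n)
    then show ?case
      using deg_le_mult[of A 1 "op_pow q A n" "int n"] top_coeff_mult[of A 1 "op_pow q A n" "int n"] assms
      by (simp add: monic1_def)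
  qed
  then show "deg_le (op_pow q A n) (int n)" "op_pow q A n (int n) = 1" by auto
qed

text \<open>\<open>chain A B n X\<close> is \<open>\<Sum>\<^sub>k\<^sub><\<^sub>n A\<^sup>k X B\<^sup>n\<^sup>-\<^sup>1\<^sup>-\<^sup>k\<close>.\<close>

primrec chain :: "qop \<Rightarrow> qop \<Rightarrow> nat \<Rightarrow> qop \<Rightarrow> qop" where
  "chain A B 0 X = 0"
| "chain A B (Suc n) X = X \<star> op_pow q B n + A \<star> chain A B n X"

lemma K_chain [simp]: "A \<in> K \<Longrightarrow> B \<in> K \<Longrightarrow> X \<in> K \<Longrightarrow> chain A B n X \<in> K"
  by (induction n) auto

lemma chain_diff:
  assumes "A \<in> K" "B \<in> K" "X \<in> K" "Y \<in> K"
  shows "chain A B n (X - Y) = chain A B n X - chain A B n Y"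
  using assms by (induction n) (simp_all add: op_ring_simps)

lemma pow_diff_eq_chain:
  assumes "A \<in> K" "B \<in> K"
  shows "op_pow q A n - op_pow q B n = chain A B n (A - B)"
proof (induction n)
  case (Suc n)
  then show ?case
    unfolding chain.simps Suc[symmetric] using assms by (simp add: op_ring_simps)
qed simp

text \<open>The Leibniz rule for the inner derivation given by \<open>Z\<close>.
  \<open>dop_pow_eq_chain\<close> has the same form, which lets \<open>E_P\<close> compare the
  two.\<close>

lemma comm_pow_eq_chain:
  assumes "A \<in> K" "Z \<in> K"
  shows "\<lbrakk>op_pow q A n, Z\<rbrakk> = chain A A n \<lbrakk>A, Z\<rbrakk>"
proof (induction n)
  case (Suc n)
  then show ?case
    unfolding chain.simps Suc[symmetric] using assms by (simp add: op_ring_simps)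
qed (simp add: op_comm_eq)

text \<open>As \<open>A\<close> and \<open>B\<close> are monic of order one, each summand
  \<open>A^k X B^(n-1-k)\<close> has the coefficient \<open>\<sigma> k (X d)\<close> in degree
  \<open>d + n - 1\<close>.\<close>

lemma chain_top:
  assumes "monic1 A" "monic1 B" "deg_le X d"
  shows "deg_le (chain A B n X) (d + int n - 1)"
    and "chain A B n X (d + int n - 1) = cyc q n (X d)"
proof -
  have "deg_le (chain A B n X) (d + int n - 1) \<and> chain A B n X (d + int n - 1) = cyc q n (X d)"
  proof (induction n)
    case 0
    show ?case by (simp add: cyc_def deg_le_def)
  next
    case (Suc n)
    have e: "d + int (Suc n) - 1 = d + int n" "1 + (d + int n - 1) = d + int n" by simp_all
    have "cyc q (Suc n) (X d) = X d + \<sigma> 1 (cyc q n (X d))"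
      unfolding cyc_def sum.lessThan_Suc_shift
      by (simp add: shift_sum shift_shift add.commute)
    moreover note deg_le_mult[OF assms(3) monic1_pow(1)[OF assms(2), of n]]
      top_coeff_mult[OF assms(3) monic1_pow(1)[OF assms(2), of n]]
      deg_le_mult[of A 1 _ "d + int n - 1"] top_coeff_mult[of A 1 _ "d + int n - 1"]
    ultimately show ?case using Suc assms(1) monic1_pow(2)[OF assms(2), of n]
      unfolding e monic1_def chain.simps by (intro conjI deg_le_add) (simp_all add: e)
  qed
  then show "deg_le (chain A B n X) (d + int n - 1)"
    "chain A B n X (d + int n - 1) = cyc q n (X d)" by auto
qed

end

section \<open>Evolutionary derivations\<close>

definition pder :: "nat \<times> int \<Rightarrow> tseries \<Rightarrow> tseries" where
  "pder x f = Abs_tseries (\<lambda>\<mu>. of_nat (count \<mu> x + 1) * coeff f (add_mset x \<mu>))"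

lemma coeff_pder: "coeff (pder x f) \<mu> = of_nat (count \<mu> x + 1) * coeff f (add_mset x \<mu>)"
  by (simp add: pder_def)

text \<open>One half of the Leibniz rule. Terms with \<open>x\<close> not in \<open>\<alpha>\<close>
  have factor zero; in the others one \<open>x\<close> is removed from
  \<open>\<alpha>\<close>.\<close>

lemma sum_splits_add_mset:
  fixes F :: "(nat \<times> int) multiset \<Rightarrow> (nat \<times> int) multiset \<Rightarrow> complex"
  shows "(\<Sum>(\<alpha>, \<beta>) \<in> splits (add_mset x \<mu>). of_nat (count \<alpha> x) * F \<alpha> \<beta>) =
    (\<Sum>(\<alpha>, \<beta>) \<in> splits \<mu>. of_nat (count \<alpha> x + 1) * F (add_mset x \<alpha>) \<beta>)"
    (is "sum ?G _ = sum ?H _")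
proof -
  have "sum ?G (splits (add_mset x \<mu>)) = sum ?G {p \<in> splits (add_mset x \<mu>). x \<in># fst p}"
    by (rule sum.mono_neutral_right) (auto simp: not_in_iff)
  also have "\<dots> = sum ?H (splits \<mu>)"
    by (rule sum.reindex_bij_witness[where j = "\<lambda>(\<alpha>, \<beta>). (\<alpha> - {#x#}, \<beta>)"
          and i = "\<lambda>(\<alpha>, \<beta>). (add_mset x \<alpha>, \<beta>)"])
      (auto simp: splits_def dest!: multi_member_split)
  finally show ?thesis .
qed

lemma pder_mult: "pder x (f * g) = pder x f * g + f * pder x g"
proof (rule tseries_eqI)
  fix \<mu>
  have "coeff (pder x (f * g)) \<mu> = (\<Sum>(\<alpha>, \<beta>) \<in> splits (add_mset x \<mu>).
      of_nat (count \<mu> x + 1) * (coeff f \<alpha> * coeff g \<beta>))"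
    by (simp add: coeff_pder coeff_times sum_distrib_left case_prod_unfold)
  \<comment> \<open>The exponent of \<open>x\<close> in a product is the sum of its exponents in the
    two factors.\<close>
  also have "\<dots> = (\<Sum>(\<alpha>, \<beta>) \<in> splits (add_mset x \<mu>). of_nat (count \<alpha> x) * (coeff f \<alpha> * coeff g \<beta>))
      + (\<Sum>(\<alpha>, \<beta>) \<in> splits (add_mset x \<mu>). of_nat (count \<beta> x) * (coeff f \<alpha> * coeff g \<beta>))"
    unfolding sum.distrib[symmetric]
  proof (rule sum.cong[OF refl], clarify)
    fix \<alpha> \<beta> assume "(\<alpha>, \<beta>) \<in> splits (add_mset x \<mu>)"
    then have "count (\<alpha> + \<beta>) x = count \<mu> x + 1" by (simp add: splits_def)
    then have "(of_nat (count \<mu> x + 1) :: complex) = of_nat (count \<alpha> x) + of_nat (count \<beta> x)"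
      by (metis count_union of_nat_add)
    then show "of_nat (count \<mu> x + 1) * (coeff f \<alpha> * coeff g \<beta>) =
        of_nat (count \<alpha> x) * (coeff f \<alpha> * coeff g \<beta>) + of_nat (count \<beta> x) * (coeff f \<alpha> * coeff g \<beta>)"
      by (simp only: ring_distribs)
  qed
  also have "(\<Sum>(\<alpha>, \<beta>) \<in> splits (add_mset x \<mu>). of_nat (count \<alpha> x) * (coeff f \<alpha> * coeff g \<beta>)) =
      coeff (pder x f * g) \<mu>"
    by (simp add: sum_splits_add_mset coeff_times coeff_pder mult.assoc)
  also have "(\<Sum>(\<alpha>, \<beta>) \<in> splits (add_mset x \<mu>). of_nat (count \<beta> x) * (coeff f \<alpha> * coeff g \<beta>)) =
      (\<Sum>(\<alpha>, \<beta>) \<in> splits (add_mset x \<mu>). of_nat (count \<alpha> x) * (coeff f \<beta> * coeff g \<alpha>))"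
    by (rule sum.reindex_bij_witness[where i = prod.swap and j = prod.swap])
      (auto simp: splits_def add.commute)
  also have "\<dots> = coeff (pder x g * f) \<mu>"
    unfolding sum_splits_add_mset coeff_times
    by (intro sum.cong refl) (auto simp: coeff_pder mult_ac)
  finally show "coeff (pder x (f * g)) \<mu> = coeff (pder x f * g + f * pder x g) \<mu>"
    by (simp add: mult.commute)
qed

lemma pder_plus: "pder x (f + g) = pder x f + pder x g"
  by (rule tseries_eqI) (simp add: coeff_pder ring_distribs)

lemma pder_const: "pder x (const c) = 0"
  by (rule tseries_eqI) (simp add: coeff_pder coeff_const)

lemma pder_tgen: "pder (i, m) (tgen j) = (if i = j then 1 else 0)"
  by (rule tseries_eqI) (auto simp: coeff_pder coeff_tgen coeff_one)

text \<open>The derivation \<open>\<Sum>\<^sub>i\<^sub>,\<^sub>m R\<^sub>i[m] \<partial>/\<partial>t\<^sub>i[m]\<close>. It is defined on all series, because only the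
  finitely many \<open>m\<close> that are weights of divisors of \<open>\<nu>\<close> contribute to the coefficient at \<open>\<nu>\<close>.\<close>

definition evol :: "nat \<Rightarrow> (nat \<Rightarrow> tseries) \<Rightarrow> tseries \<Rightarrow> tseries" where
  "evol N R f = Abs_tseries (\<lambda>\<nu>. \<Sum>(\<alpha>, \<beta>) \<in> splits \<nu>. \<Sum>i\<in>{1..N}.
     coeff (R i) \<alpha> * coeff (pder (i, weight \<alpha>) f) \<beta>)"

lemma coeff_evol: "coeff (evol N R f) \<nu> = (\<Sum>p \<in> splits \<nu>. \<Sum>i\<in>{1..N}.
     coeff (R i) (fst p) * coeff (pder (i, weight (fst p)) f) (snd p))"
  by (simp add: evol_def case_prod_unfold)

lemma evol_plus: "evol N R (f + g) = evol N R f + evol N R g"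
  by (rule tseries_eqI) (simp add: coeff_evol pder_plus ring_distribs sum.distrib)

lemma evol_const [simp]: "evol N R (const c) = 0"
  by (rule tseries_eqI) (simp add: coeff_evol pder_const)

lemma evol_tgen:
  assumes "1 \<le> j" "j \<le> N"
  shows "evol N R (tgen j) = R j"
proof (rule tseries_eqI)
  fix \<nu>
  have "coeff (evol N R (tgen j)) \<nu> = (\<Sum>p \<in> splits \<nu>. \<Sum>i\<in>{1..N}.
      if i = j then coeff (R j) (fst p) * coeff 1 (snd p) else 0)"
    unfolding coeff_evol by (intro sum.cong refl) (simp add: pder_tgen)
  also have "\<dots> = coeff (R j * 1) \<nu>"
    unfolding coeff_times using assms by (simp add: case_prod_unfold)
  finally show "coeff (evol N R (tgen j)) \<nu> = coeff (R j) \<nu>" by simp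
qed

text \<open>The variable of the derivative depends on the first factor, so associativity of the
  product does not apply directly; factorizations into three parts are regrouped instead.\<close>

lemma coeff_evol_mult_left:
  "coeff (evol N R f * g) \<nu> = (\<Sum>p \<in> splits \<nu>. \<Sum>i\<in>{1..N}.
     coeff (R i) (fst p) * coeff (pder (i, weight (fst p)) f * g) (snd p))"
proof -
  define F where "F \<alpha> \<beta> \<gamma> = (\<Sum>i\<in>{1..N}. coeff (R i) \<alpha> * coeff (pder (i, weight \<alpha>) f) \<beta> * coeff g \<gamma>)"
    for \<alpha> \<beta> \<gamma>
  let ?A = "SIGMA p : splits \<nu>. splits (fst p)"
  let ?B = "SIGMA p : splits \<nu>. splits (snd p)"
  have "coeff (evol N R f * g) \<nu> = (\<Sum>p \<in> splits \<nu>. \<Sum>r \<in> splits (fst p). F (fst r) (snd r) (snd p))"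
    by (simp add: coeff_times coeff_evol case_prod_unfold sum_distrib_right F_def)
  also have "\<dots> = (\<Sum>(p, r) \<in> ?A. F (fst r) (snd r) (snd p))"
    by (simp add: sum.Sigma)
  also have "\<dots> = (\<Sum>(p, r) \<in> ?B. F (fst p) (fst r) (snd r))"
    by (rule sum.reindex_bij_witness
        [where j = "\<lambda>((ab, c), (a, b)). ((a, b + c), (b, c))"
           and i = "\<lambda>((a, bc), (b, c)). ((a + b, c), (a, b))"])
      (auto simp: splits_def add.assoc)
  also have "\<dots> = (\<Sum>p \<in> splits \<nu>. \<Sum>r \<in> splits (snd p). F (fst p) (fst r) (snd r))"
    by (simp add: sum.Sigma)
  also have "\<dots> = (\<Sum>p \<in> splits \<nu>. \<Sum>i\<in>{1..N}.
      coeff (R i) (fst p) * coeff (pder (i, weight (fst p)) f * g) (snd p))"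
    unfolding F_def by (subst sum.swap)
      (simp add: coeff_times case_prod_unfold sum_distrib_left mult.assoc)
  finally show ?thesis .
qed

lemma evol_mult: "evol N R (f * g) = evol N R f * g + f * evol N R g"
proof (rule tseries_eqI)
  fix \<nu>
  have "coeff (evol N R (f * g)) \<nu> = coeff (evol N R f * g) \<nu> + coeff (evol N R g * f) \<nu>"
    unfolding coeff_evol_mult_left coeff_evol
    by (simp add: pder_mult ring_distribs sum.distrib mult.commute[of f "pder _ g"])
  then show "coeff (evol N R (f * g)) \<nu> = coeff (evol N R f * g + f * evol N R g) \<nu>"
    by (simp add: mult.commute)
qed

text \<open>The derivation replaces a variable of weight \<open>m\<close> by monomials of weight
  \<open>m\<close>. It therefore commutes with multiplying coefficients by a function of the weight,
  as \<open>shift\<close>, \<open>integ\<close> and negation do.\<close>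

lemma evol_weight_multiplier:
  assumes "\<And>\<mu>. coeff g \<mu> = u (weight \<mu>) * coeff f \<mu>"
  shows "coeff (evol N R g) \<nu> = u (weight \<nu>) * coeff (evol N R f) \<nu>"
  unfolding coeff_evol sum_distrib_left
  by (intro sum.cong refl) (auto simp: coeff_pder assms dest!: splitsD)

lemma evol_shift: "evol N R (shift q k f) = shift q k (evol N R f)"
  by (rule tseries_eqI)
    (use evol_weight_multiplier[of "shift q k f" "\<lambda>m. q powi (- k * m)"] in simp)

lemma evol_integ: "evol N R (integ f) = integ (evol N R f)"
  by (rule tseries_eqI)
    (use evol_weight_multiplier[of "integ f" "\<lambda>m. if m = 0 then 1 else 0" f] in \<open>simp add: coeff_integ\<close>)

lemma evol_uminus: "evol N R (- f) = - evol N R f"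
  by (rule tseries_eqI)
    (use evol_weight_multiplier[of "- f" "\<lambda>m. - 1"] in simp)

lemma evol_minus: "evol N R (f - g) = evol N R f - evol N R g"
  using evol_plus[of N R f "- g"] by (simp add: evol_uminus)

lemma evol_zero [simp]: "evol N R 0 = 0"
  using evol_minus[of N R 0 0] by simp

lemma evol_one [simp]: "evol N R 1 = 0"
  by (simp add: one_eq_const)

lemma evol_sum: "evol N R (sum f A) = (\<Sum>a\<in>A. evol N R (f a))"
  by (induction A rule: infinite_finite_induct) (auto simp: evol_plus)

lemma evol_cyc: "evol N R (cyc q M f) = cyc q M (evol N R f)"
  by (simp add: cyc_def evol_sum evol_shift)

lemma evol_Rq:
  assumes "\<And>i. 1 \<le> i \<Longrightarrow> i \<le> N \<Longrightarrow> R i \<in> Rq q N" "f \<in> Rq q N"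
  shows "evol N R f \<in> Rq q N"
  using assms(2)
proof induction
  case (base f)
  then show ?case
  proof induction
    case (mult f g)
    then show ?case by (simp add: evol_mult Rq.add Rq.mult Rq.base)
  qed (auto simp: evol_plus evol_shift evol_tgen assms intro!: Rq.add Rq.shift)
next
  \<comment> \<open>As \<open>evol\<close> commutes with \<open>cyc\<close>, the derivative of an
    adjoined solution again solves an equation with right side in the ring.\<close>
  case (solve f)
  then show ?case by (auto simp: evol_cyc intro: Rq.solve)
qed (auto simp: evol_plus evol_mult evol_shift intro!: Rq.add Rq.mult Rq.shift)

context qshift
begin

abbreviation dop :: "nat \<Rightarrow> (nat \<Rightarrow> tseries) \<Rightarrow> qop \<Rightarrow> qop" where
  "dop N R A \<equiv> (\<lambda>n. evol N R (A n))"

lemma deg_le_dop: "deg_le A a \<Longrightarrow> deg_le (dop N R A) a"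
  by (auto simp: deg_le_def)

lemma K_dop [simp]: "A \<in> K \<Longrightarrow> dop N R A \<in> K"
  by (auto simp: K_def intro: deg_le_dop)

lemma dop_diff: "dop N R (A - B) = dop N R A - dop N R B"
  and dop_one: "dop N R op_one = 0"
  by (auto simp: evol_minus op_one_def)

lemma dop_mult:
  assumes "A \<in> K" "B \<in> K"
  shows "dop N R (A \<star> B) = dop N R A \<star> B + A \<star> dop N R B"
proof
  fix n
  obtain a b where ab: "deg_le A a" "deg_le B b"
    using assms by (auto simp: K_def)
  note eqs = op_mult_eq[OF _ _ order_refl order_refl]
  show "evol N R ((A \<star> B) n) = (dop N R A \<star> B + A \<star> dop N R B) n"
    by (simp add: eqs[OF ab] eqs[OF deg_le_dop[OF ab(1)] ab(2)] eqs[OF ab(1) deg_le_dop[OF ab(2)]]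
        evol_sum evol_mult evol_shift sum.distrib)
qed

lemma dop_comm:
  assumes "A \<in> K" "B \<in> K"
  shows "dop N R \<lbrakk>A, B\<rbrakk> = \<lbrakk>dop N R A, B\<rbrakk> + \<lbrakk>A, dop N R B\<rbrakk>"
  using assms by (simp add: op_comm_eq dop_diff dop_mult del: minus_apply)

lemma dop_pow_eq_chain:
  assumes "A \<in> K"
  shows "dop N R (op_pow q A n) = chain A A n (dop N R A)"
  using assms by (induction n) (simp_all add: dop_one dop_mult)

subsection \<open>Positive part and residue\<close>

definition nonneg_op :: "qop \<Rightarrow> bool" where
  "nonneg_op A \<longleftrightarrow> (\<forall>n<0. A n = 0)"

lemma plus_part_add: "op_plus_part (A + B) = op_plus_part A + op_plus_part B"
  and plus_part_diff: "op_plus_part (A - B) = op_plus_part A - op_plus_part B"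
  and plus_part_uminus: "op_plus_part (- A) = - op_plus_part A"
  and plus_part_dop: "dop N R (op_plus_part A) = op_plus_part (dop N R A)"
  and plus_part_nonneg: "nonneg_op A \<Longrightarrow> op_plus_part A = A"
  and plus_part_neg: "deg_le A (- 1) \<Longrightarrow> op_plus_part A = 0"
  and nonneg_plus_part: "nonneg_op (op_plus_part A)"
  by (auto simp: op_plus_part_def nonneg_op_def deg_le_def)

lemma K_plus_part [simp]: "A \<in> K \<Longrightarrow> op_plus_part A \<in> K"
  by (auto simp: K_def deg_le_def op_plus_part_def)

lemma neg_part_deg: "deg_le (A - op_plus_part A) (- 1)"
  by (auto simp: deg_le_def op_plus_part_def)

lemma nonneg_mult: "nonneg_op A \<Longrightarrow> nonneg_op B \<Longrightarrow> nonneg_op (A \<star> B)"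
  unfolding nonneg_op_def op_mult_def
  by (auto intro!: sum.neutral) (metis (no_types) diff_less_0_iff_less less_le_trans not_less)

lemma nonneg_comm: "nonneg_op A \<Longrightarrow> nonneg_op B \<Longrightarrow> nonneg_op \<lbrakk>A, B\<rbrakk>"
  using nonneg_mult[of A B] nonneg_mult[of B A] by (simp add: op_comm_eq nonneg_op_def)

text \<open>For commuting \<open>X\<close> and \<open>Y\<close> this is the zero-curvature equation once
  \<open>\<partial>Y = [Y, X\<^sub>+]\<close> and \<open>\<partial>'X = [X, Y\<^sub>+]\<close> are inserted.\<close>

lemma zero_curvature:
  assumes "X \<in> K" "Y \<in> K" "\<lbrakk>X, Y\<rbrakk> = 0"
  shows "\<lbrakk>op_plus_part X, op_plus_part Y\<rbrakk> + op_plus_part \<lbrakk>Y, op_plus_part X\<rbrakk>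
    - op_plus_part \<lbrakk>X, op_plus_part Y\<rbrakk> = 0"
proof -
  define A B where "A = op_plus_part X" and "B = op_plus_part Y"
  define A' B' where "A' = X - A" and "B' = Y - B"
  have K: "A \<in> K" "B \<in> K" "A' \<in> K" "B' \<in> K"
    using assms by (simp_all add: A_def B_def A'_def B'_def)
  have X: "X = A + A'" "Y = B + B'" by (simp_all add: A'_def B'_def)
  have nn: "nonneg_op \<lbrakk>A, B\<rbrakk>" "nonneg_op \<lbrakk>B, A\<rbrakk>"
    by (auto intro!: nonneg_comm simp: A_def B_def nonneg_plus_part)
  have neg: "deg_le A' (- 1)" "deg_le B' (- 1)"
    unfolding A'_def B'_def A_def B_def by (rule neg_part_deg)+
  \<comment> \<open>A product of two operators of order at most -1 has order at most -2, so this
    commutator has zero positive part.\<close>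
  have "deg_le \<lbrakk>A', B'\<rbrakk> (- 1 + - 1)"
    unfolding op_comm_eq using neg by (intro deg_le_diff deg_le_mult)
  then have neg2: "deg_le \<lbrakk>A', B'\<rbrakk> (- 1)" by (rule deg_le_mono) simp
  have expand: "\<lbrakk>X, Y\<rbrakk> = \<lbrakk>A, B\<rbrakk> + \<lbrakk>A, B'\<rbrakk> + \<lbrakk>A', B\<rbrakk> + \<lbrakk>A', B'\<rbrakk>"
    unfolding X using K by (simp add: op_ring_simps algebra_simps)
  have "op_plus_part \<lbrakk>X, Y\<rbrakk> = \<lbrakk>A, B\<rbrakk> + op_plus_part \<lbrakk>A, B'\<rbrakk> + op_plus_part \<lbrakk>A', B\<rbrakk>"
    unfolding expand using nn neg2 by (simp add: plus_part_add plus_part_nonneg plus_part_neg)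
  then have 1: "\<lbrakk>A, B\<rbrakk> + op_plus_part \<lbrakk>A, B'\<rbrakk> + op_plus_part \<lbrakk>A', B\<rbrakk> = 0"
    using assms(3) plus_part_neg[OF deg_le_0] by simp
  have "\<lbrakk>Y, A\<rbrakk> = \<lbrakk>B, A\<rbrakk> - \<lbrakk>A, B'\<rbrakk>" "\<lbrakk>X, B\<rbrakk> = \<lbrakk>A, B\<rbrakk> + \<lbrakk>A', B\<rbrakk>" "\<lbrakk>B, A\<rbrakk> = - \<lbrakk>A, B\<rbrakk>"
    unfolding X using K by (simp_all add: op_ring_simps algebra_simps)
  then have "\<lbrakk>A, B\<rbrakk> + op_plus_part \<lbrakk>Y, A\<rbrakk> - op_plus_part \<lbrakk>X, B\<rbrakk> =
      - (\<lbrakk>A, B\<rbrakk> + op_plus_part \<lbrakk>A, B'\<rbrakk> + op_plus_part \<lbrakk>A', B\<rbrakk>)"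
    using nn by (simp add: plus_part_add plus_part_diff plus_part_nonneg plus_part_uminus)
  also have "\<dots> = 0" unfolding 1 by (rule minus_zero)
  finally show ?thesis unfolding A_def B_def .
qed

text \<open>Pairing index \<open>k\<close> of one product with \<open>-k\<close> of the other, the
  terms differ by a shift, and shifts fix the part of weight 0.\<close>

lemma integ_Res_comm:
  assumes "A \<in> K" "B \<in> K"
  shows "integ (op_Res \<lbrakk>A, B\<rbrakk>) = 0"
proof -
  obtain a b where ab: "deg_le A a" "deg_le B b" using assms by (auto simp: K_def)
  have 1: "(A \<star> B) 0 = (\<Sum>k\<in>{-b..a}. A k * \<sigma> k (B (- k)))"
    using op_mult_eq[OF ab order_refl order_refl, of 0] by simp
  have "(B \<star> A) 0 = (\<Sum>k\<in>{-a..b}. B k * \<sigma> k (A (- k)))"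
    using op_mult_eq[OF ab(2,1) order_refl order_refl, of 0] by simp
  also have "\<dots> = (\<Sum>k\<in>{-b..a}. \<sigma> (- k) (A k * \<sigma> k (B (- k))))"
    by (rule sum.reindex_bij_witness[where i = uminus and j = uminus])
      (auto simp: shift_mult shift_shift mult.commute)
  finally have 2: "(B \<star> A) 0 = \<dots>" .
  show ?thesis
    by (rule tseries_eqI) (simp add: coeff_integ op_Res_def op_comm_def 1 2 coeff_sum)
qed

end

locale lax_setup = qshift +
  fixes N :: nat
  assumes nonroot: "\<forall>k\<ge>1. q ^ k \<noteq> 1" and N2: "N \<ge> 2"
begin

section \<open>The root of the Lax operator\<close>

lemma N1: "N \<ge> 1"
  using N2 by simp

lemmas cyc_inj' = cyc_inj[OF q_nz nonroot N1]

lemma deg_le_step: "deg_le X d \<Longrightarrow> X d = 0 \<Longrightarrow> deg_le X (d - 1)"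
  unfolding deg_le_def by (metis zle_diff1_eq not_less order_le_less linorder_neqE)

lemma deg_le_all:
  assumes "\<And>j. deg_le X (d - int j)"
  shows "X = 0"
proof
  fix n
  have "d - int (nat (d - n + 1)) < n" by linarith
  then show "X n = 0 n" by (simp only: deg_leD[OF assms] zero_fun_apply)
qed

text \<open>Each top coefficient of \<open>X\<close> is killed by the injective
  \<open>cyc q N\<close>, so the degree bound can be lowered forever.\<close>

lemma chain_inj:
  assumes "monic1 A" "monic1 B" "X \<in> K" "chain A B N X = 0"
  shows "X = 0"
proof -
  obtain d where d: "deg_le X d" using assms by (auto simp: K_def)
  have "deg_le X (d - int j)" for j
  proof (induction j)
    case (Suc j)
    have "cyc q N (X (d - int j)) = cyc q N 0"
      using chain_top(2)[OF assms(1,2) Suc, of N] assms(4) by (simp add: cyc_def)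
    then have "X (d - int j) = 0" by (rule cyc_inj')
    with Suc have "deg_le X (d - int j - 1)" by (rule deg_le_step)
    then show ?case by (simp add: algebra_simps)
  qed (use d in simp)
  then show ?thesis by (rule deg_le_all)
qed

section \<open>Closure of the coefficient ring under operations on operators\<close>

lemma pdo_iff: "A \<in> pdo q N \<longleftrightarrow> A \<in> K \<and> (\<forall>n. A n \<in> Rq q N)"
  by (auto simp: pdo_def K_def deg_le_def)

lemma Rq_op_mult:
  "(\<And>n. A n \<in> Rq q N) \<Longrightarrow> (\<And>n. B n \<in> Rq q N) \<Longrightarrow> (A \<star> B) n \<in> Rq q N"
  unfolding op_mult_def by (intro Rq_sum Rq.mult Rq.shift)

lemma Rq_op_pow: "(\<And>n. A n \<in> Rq q N) \<Longrightarrow> op_pow q A m n \<in> Rq q N"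
  by (induction m arbitrary: n) (auto simp: op_one_def intro: Rq_op_mult)

lemma Rq_op_comm:
  "(\<And>n. A n \<in> Rq q N) \<Longrightarrow> (\<And>n. B n \<in> Rq q N) \<Longrightarrow> \<lbrakk>A, B\<rbrakk> n \<in> Rq q N"
  unfolding op_comm_def by (intro Rq_diff Rq_op_mult)

lemma Rq_plus_part: "(\<And>n. A n \<in> Rq q N) \<Longrightarrow> op_plus_part A n \<in> Rq q N"
  by (simp add: op_plus_part_def)

lemma Rq_lax: "lax N n \<in> Rq q N"
proof -
  have "(- 1) ^ k * tgen k \<in> Rq q N" if "1 \<le> k" "k \<le> N" for k
    using minus_one_power_cases[of k] Rq_tgen[OF that, of q] by (auto intro: Rq_uminus)
  from this[of "N - nat n"] show ?thesis by (auto simp: lax_def)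
qed

lemma deg_le_lax: "deg_le (lax N) (int N)" and lax_top: "lax N (int N) = 1"
  by (auto simp: deg_le_def lax_def)

lemma K_lax [simp]: "lax N \<in> K"
  using deg_le_lax deg_le_K by blast

text \<open>Two different operators in \<open>chain\<close> are needed here:
  \<open>P^N - Q^N\<close> is the image of \<open>P - Q\<close> under the injective
  \<open>chain P Q N\<close>.\<close>

lemma lax_root_unique:
  assumes "is_lax_root q N P" "is_lax_root q N Q"
  shows "P = Q"
proof -
  have m: "monic1 P" "monic1 Q"
    using assms by (auto simp: is_lax_root_def monic1_def deg_le_def)
  have "chain P Q N (P - Q) = op_pow q P N - op_pow q Q N"
    using m by (intro pow_diff_eq_chain[symmetric]) simp_all
  also have "\<dots> = 0"
    using assms by (simp add: is_lax_root_def)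
  finally have "P - Q = 0"
    by (rule chain_inj[OF m, rotated]) (use m in simp)
  then show ?thesis by simp
qed

text \<open>The \<open>m\<close>-th approximation of the root: its \<open>N\<close>-th power agrees with \<open>L\<close> in degrees above
  \<open>N - 1 - m\<close>.\<close>

primrec approx_root :: "nat \<Rightarrow> qop" where
  "approx_root 0 = (\<lambda>n. if n = 1 then 1 else 0)"
| "approx_root (Suc m) = (approx_root m)(- int m := approx_root m (- int m) +
     inv (cyc q N) ((lax N - op_pow q (approx_root m) N) (int N - 1 - int m)))"

lemma cyc_inv: "cyc q N (inv (cyc q N) f) = f"
  using cyc_surj[OF q_nz nonroot N1] by (metis surj_f_inv_f surjI surj_def)

lemma approx_root:
  "monic1 (approx_root m) \<and> (\<forall>n. approx_root m n \<in> Rq q N) \<and>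
     deg_le (lax N - op_pow q (approx_root m) N) (int N - 1 - int m)"
proof (induction m)
  case 0
  have m: "monic1 (approx_root 0)" by (simp add: monic1_def deg_le_def)
  have "deg_le (lax N - op_pow q (approx_root 0) N) (int N - 1)"
    using monic1_pow[OF m, of N] deg_le_lax lax_top by (intro deg_le_step deg_le_diff) simp_all
  then have "deg_le (lax N - op_pow q (approx_root 0) N) (int N - 1 - int 0)"
    by (simp only: of_nat_0 diff_zero)
  moreover have "\<forall>n. approx_root 0 n \<in> Rq q N" by simp
  ultimately show ?case using m by blast
next
  case (Suc m)
  let ?C = "approx_root m" and ?C' = "approx_root (Suc m)"
  let ?r = "lax N - op_pow q ?C N" and ?d = "int N - 1 - int m"
  have m: "monic1 ?C" "monic1 ?C'"
    using Suc by (auto simp: monic1_def deg_le_def)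
  \<comment> \<open>\<open>inv\<close> picks a preimage among all series; the rule
    \<open>Rq.solve\<close> then places it in the ring.\<close>
  have "cyc q N (inv (cyc q N) (?r ?d)) \<in> Rq q N"
    unfolding cyc_inv using Suc Rq_op_pow[of ?C N] by (simp add: Rq_diff Rq_lax)
  then have Rq: "?C' n \<in> Rq q N" for n
    using Suc by (auto intro: Rq.add dest: Rq.solve)
  have X: "deg_le (?C' - ?C) (- int m)" "(?C' - ?C) (- int m) = inv (cyc q N) (?r ?d)"
    by (auto simp: deg_le_def)
  \<comment> \<open>By \<open>chain_top\<close>, a correction in degree \<open>-m\<close> changes
    the power first in degree \<open>N - 1 - m\<close>, by its image under \<open>cyc q N\<close>;
    this cancels the leading error.\<close>
  have K: "op_pow q ?C' N - op_pow q ?C N = chain ?C' ?C N (?C' - ?C)"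
    using m by (intro pow_diff_eq_chain) simp_all
  have top: "deg_le (op_pow q ?C' N - op_pow q ?C N) ?d"
    "(op_pow q ?C' N - op_pow q ?C N) ?d = ?r ?d"
    using chain_top[OF m(2,1) X(1), of N] unfolding K X(2) cyc_inv
    by (simp_all add: algebra_simps)
  have "lax N - op_pow q ?C' N = ?r - (op_pow q ?C' N - op_pow q ?C N)"
    by simp
  moreover have "deg_le \<dots> (?d - 1)"
  proof (rule deg_le_step)
    show "deg_le (?r - (op_pow q ?C' N - op_pow q ?C N)) ?d"
      using Suc top(1) by (intro deg_le_diff[of ?r]) blast+
    show "(?r - (op_pow q ?C' N - op_pow q ?C N)) ?d = 0"
      unfolding minus_apply[of ?r] top(2) by (rule diff_self)
  qed
  moreover have "?d - 1 = int N - 1 - int (Suc m)" by simp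
  ultimately have "deg_le (lax N - op_pow q ?C' N) (int N - 1 - int (Suc m))"
    by (simp only:)
  with m Rq show ?case by blast
qed

lemma approx_root_stable: "- int m < n \<Longrightarrow> m \<le> m' \<Longrightarrow> approx_root m' n = approx_root m n"
  by (induction m') (auto simp: le_Suc_eq)

lemma lax_root_exists: "\<exists>P. is_lax_root q N P"
proof
  \<comment> \<open>Passing from stage \<open>m\<close> to the next alters degree \<open>-m\<close>
    only, so the coefficient of degree \<open>n\<close> is final from stage
    \<open>nat (1 - n)\<close> on.\<close>
  define P where "P = (\<lambda>n. approx_root (nat (1 - n)) n)"
  have P: "P n = approx_root m n" if "- int m < n" for m n
  proof -
    have "approx_root (max m (nat (1 - n))) n = approx_root m n"
      by (rule approx_root_stable) (use that in auto)
    moreover have "approx_root (max m (nat (1 - n))) n = approx_root (nat (1 - n)) n"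
      by (rule approx_root_stable) auto
    ultimately show ?thesis by (simp add: P_def)
  qed
  have m: "monic1 P"
    using P[of 0] approx_root[of 0] by (auto simp: monic1_def deg_le_def)
  \<comment> \<open>\<open>P\<close> and stage \<open>m\<close> differ only in degrees at most
    \<open>-m\<close>, so their powers differ only in degrees at most
    \<open>N - 1 - m\<close>.\<close>
  have "deg_le (lax N - op_pow q P N) (int N - 1 - int m)" for m
  proof -
    let ?C = "approx_root m"
    have C: "monic1 ?C" "deg_le (lax N - op_pow q ?C N) (int N - 1 - int m)"
      using approx_root by auto
    have "deg_le (P - ?C) (- int m)" using P by (simp add: deg_le_def)
    then have "deg_le (chain P ?C N (P - ?C)) (int N - 1 - int m)"
      using chain_top(1)[OF m C(1), of "P - ?C" "- int m" N] by (simp add: algebra_simps)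
    then have "deg_le ((lax N - op_pow q ?C N) - (op_pow q P N - op_pow q ?C N)) (int N - 1 - int m)"
      unfolding pow_diff_eq_chain[OF monic1_K[OF m] monic1_K[OF C(1)]] by (intro deg_le_diff C(2))
    then show ?thesis by simp
  qed
  then have "lax N - op_pow q P N = 0" by (rule deg_le_all)
  then have "op_pow q P N = lax N" by simp
  moreover have "P n \<in> Rq q N" for n
    using approx_root by (simp add: P_def)
  ultimately show "is_lax_root q N P"
    using m by (auto simp: is_lax_root_def pdo_iff monic1_def deg_le_def)
qed

abbreviation P :: qop where "P \<equiv> lax_root q N"

lemma is_lax_root: "is_lax_root q N P"
  using theI'[of "is_lax_root q N"] lax_root_exists lax_root_unique
  unfolding lax_root_def by blast

lemma monic1_P: "monic1 P" and P_pow_N: "op_pow q P N = lax N" and Rq_P: "P n \<in> Rq q N"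
  using is_lax_root by (auto simp: is_lax_root_def monic1_def deg_le_def pdo_iff)

lemma K_P [simp]: "P \<in> K"
  using monic1_P by simp

section \<open>The flows\<close>

abbreviation Ppos :: "nat \<Rightarrow> qop" where
  "Ppos n \<equiv> op_plus_part (op_pow q P n)"

text \<open>The sign undoes the one that \<open>t_i\<close> carries in \<open>lax N\<close>.\<close>

definition flow_field :: "nat \<Rightarrow> nat \<Rightarrow> tseries" where
  "flow_field n i = (- 1) ^ i * \<lbrakk>lax N, Ppos n\<rbrakk> (int N - int i)"

abbreviation E :: "nat \<Rightarrow> tseries \<Rightarrow> tseries" where
  "E n \<equiv> evol N (flow_field n)"

lemma Rq_lax_comm: "\<lbrakk>lax N, Ppos n\<rbrakk> k \<in> Rq q N"
  by (intro Rq_op_comm Rq_lax Rq_plus_part Rq_op_pow Rq_P)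

lemma Rq_field: "flow_field n i \<in> Rq q N"
  using minus_one_power_cases[of i] Rq_lax_comm Rq_uminus[OF Rq_lax_comm] unfolding flow_field_def by auto

lemma E_Rq: "f \<in> Rq q N \<Longrightarrow> E n f \<in> Rq q N"
  by (rule evol_Rq[OF Rq_field])

lemma lax_comm_pow: "\<lbrakk>lax N, op_pow q P n\<rbrakk> = 0"
  unfolding op_comm_eq P_pow_N[symmetric] by (simp add: op_pow_commute)

text \<open>This makes the Lax equation consistent. Both operators have no negative part; and since
  \<open>L\<close> commutes with \<open>P^n\<close>, the commutator is also minus the one with the
  negative part, of order at most \<open>N - 1\<close>.\<close>

lemma lax_comm_outside:
  assumes "k < 0 \<or> k \<ge> int N"
  shows "\<lbrakk>lax N, Ppos n\<rbrakk> k = 0"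
proof (cases "k < 0")
  case True
  have "nonneg_op (lax N)" by (simp add: nonneg_op_def lax_def)
  then have "nonneg_op \<lbrakk>lax N, Ppos n\<rbrakk>" by (intro nonneg_comm nonneg_plus_part)
  with True show ?thesis by (simp add: nonneg_op_def)
next
  case False
  let ?Q = "op_pow q P n - Ppos n"
  have "\<lbrakk>lax N, Ppos n\<rbrakk> = \<lbrakk>lax N, op_pow q P n\<rbrakk> - \<lbrakk>lax N, ?Q\<rbrakk>"
    by (simp add: op_ring_simps)
  also have "\<dots> = 0 - (lax N \<star> ?Q - ?Q \<star> lax N)"
    unfolding lax_comm_pow by (simp only: op_comm_eq)
  finally have eq: "\<lbrakk>lax N, Ppos n\<rbrakk> = 0 - (lax N \<star> ?Q - ?Q \<star> lax N)" .
  have "deg_le (0 - (lax N \<star> ?Q - ?Q \<star> lax N)) (int N - 1)"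
    using deg_le_mult[OF deg_le_lax neg_part_deg] deg_le_mult[OF neg_part_deg deg_le_lax]
    by (intro deg_le_diff) simp_all
  with False assms show ?thesis unfolding eq by (intro deg_leD) (assumption, simp)
qed

lemma E_lax: "dop N (flow_field n) (lax N) = \<lbrakk>lax N, Ppos n\<rbrakk>"
proof
  fix k
  show "E n (lax N k) = \<lbrakk>lax N, Ppos n\<rbrakk> k"
  proof (cases "k < 0 \<or> k \<ge> int N")
    case True
    then have "lax N k = 0 \<or> lax N k = 1" by (auto simp: lax_def)
    then show ?thesis using lax_comm_outside[OF True] by auto
  next
    case False
    define i where "i = N - nat k"
    have i: "1 \<le> i" "i \<le> N" "k = int N - int i" using False by (auto simp: i_def)
    have "lax N k = (- 1) ^ i * tgen i" using False by (auto simp: lax_def i_def)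
    then show ?thesis
      using minus_one_power_cases[of i] evol_tgen[OF i(1,2), of "flow_field n"] i(3)
      by (auto simp: flow_field_def evol_uminus)
  qed
qed

text \<open>Both sides of \<open>\<partial>L = [L, P\<^sup>n\<^sub>+]\<close> are images under the injective map \<open>chain P P N\<close>.\<close>

lemma E_P: "dop N (flow_field n) P = \<lbrakk>P, Ppos n\<rbrakk>"
proof -
  have "chain P P N (dop N (flow_field n) P - \<lbrakk>P, Ppos n\<rbrakk>) =
      dop N (flow_field n) (lax N) - \<lbrakk>lax N, Ppos n\<rbrakk>"
    unfolding P_pow_N[symmetric] dop_pow_eq_chain[OF K_P]
    by (simp add: chain_diff comm_pow_eq_chain)
  also have "\<dots> = 0" by (simp add: E_lax)
  finally have "dop N (flow_field n) P - \<lbrakk>P, Ppos n\<rbrakk> = 0"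
    by (rule chain_inj[OF monic1_P monic1_P, rotated]) simp
  then show ?thesis by simp
qed

lemma E_pow: "dop N (flow_field n) (op_pow q P m) = \<lbrakk>op_pow q P m, Ppos n\<rbrakk>"
  by (simp add: dop_pow_eq_chain comm_pow_eq_chain E_P)

text \<open>By the Jacobi identity, the two orders of differentiation differ by the commutator of
  \<open>L\<close> with the left side of \<open>zero_curvature\<close>.\<close>

lemma E_commute_lax: "E n (E m (lax N k)) = E m (E n (lax N k))"
proof -
  let ?X = "op_pow q P n" and ?Y = "op_pow q P m"
  let ?A = "op_plus_part ?X" and ?B = "op_plus_part ?Y" and ?L = "lax N"
  have E2: "(\<lambda>k. E n (E m (?L k))) =
      \<lbrakk>\<lbrakk>?L, Ppos n\<rbrakk>, Ppos m\<rbrakk> + \<lbrakk>?L, op_plus_part \<lbrakk>op_pow q P m, Ppos n\<rbrakk>\<rbrakk>" for n m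
  proof -
    have "(\<lambda>k. E n (E m (?L k))) = dop N (flow_field n) \<lbrakk>?L, Ppos m\<rbrakk>"
      by (simp only: fun_cong[OF E_lax])
    also have "\<dots> = \<lbrakk>dop N (flow_field n) ?L, Ppos m\<rbrakk> + \<lbrakk>?L, dop N (flow_field n) (Ppos m)\<rbrakk>"
      by (rule dop_comm) simp_all
    finally show ?thesis by (simp only: E_lax plus_part_dop E_pow)
  qed
  have "(\<lambda>k. E n (E m (?L k))) - (\<lambda>k. E m (E n (?L k))) =
      (\<lbrakk>\<lbrakk>?L, ?A\<rbrakk>, ?B\<rbrakk> - \<lbrakk>\<lbrakk>?L, ?B\<rbrakk>, ?A\<rbrakk>) + (\<lbrakk>?L, op_plus_part \<lbrakk>?Y, ?A\<rbrakk>\<rbrakk> - \<lbrakk>?L, op_plus_part \<lbrakk>?X, ?B\<rbrakk>\<rbrakk>)"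
    unfolding E2 by simp
  also have "\<dots> = \<lbrakk>?L, \<lbrakk>?A, ?B\<rbrakk> + op_plus_part \<lbrakk>?Y, ?A\<rbrakk> - op_plus_part \<lbrakk>?X, ?B\<rbrakk>\<rbrakk>"
    unfolding op_comm_jacobi[OF K_lax K_plus_part[OF K_pow[OF K_P]] K_plus_part[OF K_pow[OF K_P]]]
    by (simp only: op_ring_simps K_lax K_plus_part K_pow K_P K_mult K_add K_diff) simp
  also have "\<dots> = 0"
    by (subst zero_curvature) (simp_all add: op_comm_eq op_pow_commute)
  finally have "(\<lambda>k. E n (E m (?L k))) - (\<lambda>k. E m (E n (?L k))) = 0" .
  then show ?thesis by (simp add: fun_eq_iff)
qed

section \<open>Uniqueness of derivations with given values on the generators\<close>

lemma
  assumes "difference_derivation q N d"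
  shows derivation_add: "f \<in> Rq q N \<Longrightarrow> g \<in> Rq q N \<Longrightarrow> d (f + g) = d f + d g"
    and derivation_mult: "f \<in> Rq q N \<Longrightarrow> g \<in> Rq q N \<Longrightarrow> d (f * g) = d f * g + f * d g"
    and derivation_const: "d (const c) = 0"
    and derivation_outside: "f \<notin> Rq q N \<Longrightarrow> d f = 0"
  using assms unfolding difference_derivation_def by blast+

lemma derivation_shift:
  assumes d: "difference_derivation q N d" and f: "f \<in> Rq q N"
  shows "d (\<sigma> j f) = \<sigma> j (d f)"
proof -
  have "d (\<sigma> 1 (\<sigma> k f)) = \<sigma> 1 (d (\<sigma> k f))" for k
    using d Rq.shift[OF f, of k] unfolding difference_derivation_def by blast
  then have step: "d (\<sigma> (k + 1) f) = \<sigma> 1 (d (\<sigma> k f))" for k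
    by (simp only: shift_shift add.commute[of k 1])
  show ?thesis
  proof (induction j rule: int_induct[where k = 0])
    case (step1 i)
    show ?case unfolding step step1(2) shift_shift by (simp only: add.commute)
  next
    case (step2 i)
    have "\<sigma> (- 1) (d (\<sigma> (i - 1 + 1) f)) = d (\<sigma> (i - 1) f)"
      unfolding step by (simp add: shift_shift)
    with step2 show ?case by (simp add: shift_shift)
  qed simp
qed

lemma derivation_sum:
  assumes "difference_derivation q N d" "finite A" "\<And>a. a \<in> A \<Longrightarrow> F a \<in> Rq q N"
  shows "d (sum F A) = (\<Sum>a\<in>A. d (F a))"
proof -
  have "d (const 0) = 0" by (rule derivation_const[OF assms(1)])
  moreover have "const 0 = 0" by (rule tseries_eqI) (simp add: coeff_const)
  ultimately have 0: "d 0 = 0" by simp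
  show ?thesis using assms(2,3)
  proof (induction A)
    case (insert a A)
    then show ?case by (simp add: derivation_add[OF assms(1)] Rq_sum)
  qed (simp add: 0)
qed

text \<open>Values on adjoined solutions are forced as well, because a derivation commuting with
  \<open>D\<close> commutes with the injective \<open>cyc q N\<close>.\<close>

lemma derivation_eqI:
  assumes d: "difference_derivation q N d" and d': "difference_derivation q N d'"
    and gen: "\<And>i. 1 \<le> i \<Longrightarrow> i \<le> N \<Longrightarrow> d (tgen i) = d' (tgen i)"
  shows "d = d'"
proof
  fix f
  show "d f = d' f"
  proof (cases "f \<in> Rq q N")
    case False
    then show ?thesis by (simp add: derivation_outside[OF d] derivation_outside[OF d'])
  next
    case True
    then show ?thesis
    proof induction
      case (base f)
      then show ?case
      proof induction
        case (gen i j)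
        then show ?case
          by (simp only: derivation_shift[OF d Rq_tgen[OF gen]] derivation_shift[OF d' Rq_tgen[OF gen]]
              assms(3)[OF gen])
      qed (simp_all add: Rq.base derivation_add[OF d] derivation_add[OF d'] derivation_mult[OF d]
          derivation_mult[OF d'] derivation_const[OF d] derivation_const[OF d'])
    next
      case (shift f j)
      then show ?case by (simp only: derivation_shift[OF d] derivation_shift[OF d'])
    next
      case (solve f)
      from solve.hyps have f: "f \<in> Rq q N" by (rule Rq.solve)
      have "e (cyc q N f) = cyc q N (e f)" if "difference_derivation q N e" for e
        unfolding cyc_def using that f by (simp add: derivation_sum derivation_shift Rq.shift)
      from this[OF d] this[OF d'] have "cyc q N (d f) = cyc q N (d' f)" using solve.IH by simp
      then show ?case by (rule cyc_inj')
    qed (simp_all add: derivation_add[OF d] derivation_add[OF d'] derivation_mult[OF d]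
        derivation_mult[OF d'])
  qed
qed

lemma evol_derivation:
  assumes "\<And>i. 1 \<le> i \<Longrightarrow> i \<le> N \<Longrightarrow> R i \<in> Rq q N"
  shows "difference_derivation q N (\<lambda>f. if f \<in> Rq q N then evol N R f else 0)"
  unfolding difference_derivation_def
  using evol_Rq[OF assms] by (auto simp: evol_plus evol_mult evol_shift Rq.add Rq.mult Rq.shift)

lemma is_flow_E: "is_flow q N n (\<lambda>f. if f \<in> Rq q N then E n f else 0)"
  unfolding is_flow_def lax_frac_pow_def
  using evol_derivation[OF Rq_field] fun_cong[OF E_lax[of n]] Rq_lax by simp

text \<open>Transfers what the Lax equation prescribes on the coefficients of \<open>L\<close> to
  the generators.\<close>

lemma tgen_eq_lax: "1 \<le> i \<Longrightarrow> i \<le> N \<Longrightarrow> tgen i = const ((- 1) ^ i) * lax N (int N - int i)"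
proof -
  assume i: "1 \<le> i" "i \<le> N"
  have "const (- 1) = - 1" using uminus_eq_const[of 1] by simp
  then have "const ((- 1) ^ i) = (- 1) ^ i"
    by (cases "even i") (simp_all add: one_eq_const[symmetric])
  moreover have "lax N (int N - int i) = (- 1) ^ i * tgen i"
    using i by (simp add: lax_def nat_diff_distrib' flip: of_nat_diff)
  ultimately show ?thesis by (simp add: mult.assoc[symmetric] power_add[symmetric])
qed

lemma is_flow_unique:
  assumes "is_flow q N n d" "is_flow q N n d'"
  shows "d = d'"
proof (rule derivation_eqI)
  show "difference_derivation q N d" "difference_derivation q N d'"
    using assms by (simp_all add: is_flow_def)
  then show "d (tgen i) = d' (tgen i)" if "1 \<le> i" "i \<le> N" for i
    using assms unfolding tgen_eq_lax[OF that]
    by (simp add: is_flow_def derivation_mult derivation_const Rq_const Rq_lax)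
qed

lemma flow_eq: "flow q N n f = (if f \<in> Rq q N then E n f else 0)"
proof -
  have "flow q N n = (\<lambda>f. if f \<in> Rq q N then E n f else 0)"
    unfolding flow_def by (rule the_equality) (use is_flow_E is_flow_unique in auto)
  then show ?thesis by simp
qed

section \<open>Commuting flows and conserved functionals\<close>

lemma E_tgen_commute:
  assumes "1 \<le> i" "i \<le> N"
  shows "E n (E m (tgen i)) = E m (E n (tgen i))"
  unfolding tgen_eq_lax[OF assms] by (simp add: evol_mult E_commute_lax)

lemma E_commute: "f \<in> Rq q N \<Longrightarrow> E n (E m f) = E m (E n f)"
proof (induction rule: Rq.induct)
  case (base f)
  then show ?case
    by induction (auto simp: evol_plus evol_mult evol_shift E_tgen_commute algebra_simps)
next
  case (solve f)
  then have "cyc q N (E n (E m f)) = cyc q N (E m (E n f))" by (simp add: evol_cyc)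
  then show ?case by (rule cyc_inj')
qed (auto simp: evol_plus evol_mult evol_shift algebra_simps)

text \<open>The description in \<open>act\<close> determines a value: as \<open>E n\<close> commutes
  with \<open>integ\<close>, the integral of \<open>E n R\<close> depends only on
  \<open>integ R\<close>.\<close>

lemma act_integ: "f \<in> Rq q N \<Longrightarrow> act q N (flow q N n) (integ f) = integ (E n f)"
  unfolding act_def by (rule the_equality) (auto simp: flow_eq evol_integ[symmetric])

lemma Res_conserved: "act q N (flow q N m) (integ (op_Res (lax_frac_pow q N n))) = 0"
proof -
  have "act q N (flow q N m) (integ (op_Res (op_pow q P n))) = integ (E m (op_pow q P n 0))"
    unfolding op_Res_def by (intro act_integ Rq_op_pow Rq_P)
  also have "\<dots> = integ (op_Res \<lbrakk>op_pow q P n, Ppos m\<rbrakk>)"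
    using fun_cong[OF E_pow] by (simp add: op_Res_def)
  also have "\<dots> = 0" by (intro integ_Res_comm) simp_all
  finally show ?thesis by (simp add: lax_frac_pow_def)
qed

end

section \<open>Restriction to a constant background\<close>

text \<open>A power of one variable factors only into powers of it, so the coefficients at these
  monomials multiply like power series.\<close>

lemma coeff_times_replicate:
  "coeff (f * g) (replicate_mset j x) =
    (\<Sum>i=0..j. coeff f (replicate_mset i x) * coeff g (replicate_mset (j - i) x))"
proof -
  have split: "\<alpha> = replicate_mset (size \<alpha>) x \<and> \<beta> = replicate_mset (j - size \<alpha>) x \<and> size \<alpha> \<le> j"
    if "\<alpha> + \<beta> = replicate_mset j x" for \<alpha> \<beta>
  proof -
    have "\<alpha> \<subseteq># replicate_mset j x" using that by (metis mset_subset_eq_add_left)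
    then obtain i where i: "i \<le> j" "\<alpha> = replicate_mset i x" by (rule msubseteq_replicate_msetE)
    have "\<beta> = replicate_mset j x - \<alpha>" using that by (metis add_diff_cancel_left')
    also have "\<dots> = replicate_mset (j - i) x" using i by (intro multiset_eqI) simp
    finally show ?thesis using i by simp
  qed
  have add: "replicate_mset i x + replicate_mset (j - i) x = replicate_mset j x" if "i \<le> j" for i
    by (rule multiset_eqI) (use that in simp)
  show ?thesis
    unfolding coeff_times
    by (rule sum.reindex_bij_witness[where j = "\<lambda>(\<alpha>, \<beta>). size \<alpha>"
          and i = "\<lambda>i. (replicate_mset i x, replicate_mset (j - i) x)"])
      (auto simp: splits_def add dest: split)
qed

lemma weight_replicate [simp]: "weight (replicate_mset j (i, 0)) = 0"
  by (induction j) auto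

lemma coeff_tgen_replicate:
  "coeff (tgen k) (replicate_mset j (i, 0)) = (if k = i \<and> j = 1 then 1 else 0)"
proof -
  have "replicate_mset j (i, 0) = {#(k, m)#} \<longleftrightarrow> j = 1 \<and> k = i \<and> m = 0" for m :: int
    by (cases j; cases "j - 1") auto
  then show ?thesis by (auto simp: coeff_tgen)
qed

lemma coeff_minus_one_power: "coeff ((- 1) ^ k * f) \<mu> = (- 1) ^ k * coeff f \<mu>"
  by (cases "even k") auto

text \<open>\<open>twist v\<close> is the substitution \<open>X \<mapsto> v X\<close> after embedding the coefficients.\<close>

definition twist :: "complex fps \<Rightarrow> complex fps \<Rightarrow> complex fps fps" where
  "twist v a = Abs_fps (\<lambda>j. fps_const (a $ j) * v ^ j)"

lemma twist_nth: "twist v a $ j = fps_const (a $ j) * v ^ j"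
  by (simp add: twist_def)

lemma twist_mult: "twist v (a * b) = twist v a * twist v b"
proof (rule fps_ext)
  fix n
  have "fps_const (\<Sum>i=0..n. a $ i * b $ (n - i)) = (\<Sum>i=0..n. fps_const (a $ i) * fps_const (b $ (n - i)))"
    by (rule fps_ext) (simp add: fps_sum_nth)
  then show "twist v (a * b) $ n = (twist v a * twist v b) $ n"
    by (simp add: twist_nth fps_mult_nth sum_distrib_right)
      (intro sum.cong refl, simp add: power_add[symmetric] mult_ac flip: fps_const_mult)
qed

lemma twist_1: "twist v 1 = 1"
  by (rule fps_ext) (simp add: twist_nth)

lemma twist_power: "twist v (a ^ n) = twist v a ^ n"
  by (induction n) (simp_all add: twist_1 twist_mult)

text \<open>The cofactor of \<open>f - g\<close> in \<open>f^n - g^n\<close> has constant term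
  \<open>n\<close>, and the ring has no zero divisors.\<close>

lemma fps_power_inj:
  fixes f g :: "complex fps fps"
  assumes "f ^ n = g ^ n" "n \<ge> 1" "f $ 0 $ 0 = 1" "g $ 0 $ 0 = 1"
  shows "f = g"
proof -
  have pow: "(h ^ k) $ 0 $ 0 = 1" if "h $ 0 $ 0 = 1" for h :: "complex fps fps" and k
    using that by (simp add: fps_power_zeroth_eq_one fps_power_zeroth)
  let ?s = "\<Sum>i<n. g ^ (n - Suc i) * f ^ i"
  have "?s $ 0 $ 0 = of_nat n"
    using assms(3,4) by (simp add: fps_sum_nth fps_mult_nth pow)
  then have "?s \<noteq> 0" using assms(2) by auto
  moreover have "(f - g) * ?s = 0"
    using power_diff_sumr2[of f n g] assms(1) by simp
  ultimately show ?thesis by simp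
qed

lemma gbinomial_nonzero:
  fixes a :: complex
  assumes "\<And>i::nat. i < k \<Longrightarrow> a \<noteq> of_nat i"
  shows "a gchoose k \<noteq> 0"
  using assms by (auto simp: gbinomial_prod_rev)

lemma fraction_not_nat:
  assumes "\<not> N dvd n" "N \<ge> 1"
  shows "complex_of_nat n / of_nat N \<noteq> of_nat i"
proof
  assume "complex_of_nat n / of_nat N = of_nat i"
  then have "complex_of_nat n = of_nat (i * N)" using assms(2) by (simp add: field_simps)
  then have "n = i * N" by (simp only: of_nat_eq_iff)
  with assms show False by simp
qed

context qshift
begin

text \<open>Setting all \<open>t\<^sub>k[m]\<close> except \<open>t\<^sub>i[0]\<close> to zero makes the coefficients commute with \<open>D\<close>. An
  operator of degree at most \<open>d\<close> becomes \<open>D\<^sup>d\<close> times a power series in \<open>t\<^sub>i[0]\<close> (the outer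
  variable) and \<open>D\<^sup>-\<^sup>1\<close> (the inner one).\<close>

definition background :: "nat \<Rightarrow> int \<Rightarrow> qop \<Rightarrow> complex fps fps" where
  "background i d A = Abs_fps (\<lambda>j. Abs_fps (\<lambda>k. coeff (A (d - int k)) (replicate_mset j (i, 0))))"

lemma background_nth: "background i d A $ j $ k = coeff (A (d - int k)) (replicate_mset j (i, 0))"
  by (simp add: background_def)

lemma background_mult:
  assumes "deg_le A a" "deg_le B b"
  shows "background i (a + b) (A \<star> B) = background i a A * background i b B"
proof (intro fps_ext)
  fix j k
  let ?r = "\<lambda>j. replicate_mset j (i, 0 :: int)"
  have "(A \<star> B) (a + b - int k) = (\<Sum>l\<in>{a - int k..a}. A l * \<sigma> l (B (a + b - int k - l)))"
    using op_mult_eq[OF assms order_refl order_refl] by simp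
  also have "\<dots> = (\<Sum>l=0..k. A (a - int l) * \<sigma> (a - int l) (B (b - int (k - l))))"
    by (rule sum.reindex_bij_witness[where i = "\<lambda>l. a - int l" and j = "\<lambda>l. nat (a - l)"])
      (auto simp: algebra_simps)
  \<comment> \<open>The shift disappears because powers of \<open>t_i[0]\<close> have weight
    0.\<close>
  finally have "background i (a + b) (A \<star> B) $ j $ k = (\<Sum>l=0..k. \<Sum>m=0..j.
      coeff (A (a - int l)) (?r m) * coeff (B (b - int (k - l))) (?r (j - m)))"
    by (simp add: background_nth coeff_sum coeff_times_replicate)
  also have "\<dots> = (\<Sum>m=0..j. \<Sum>l=0..k.
      coeff (A (a - int l)) (?r m) * coeff (B (b - int (k - l))) (?r (j - m)))"
    by (rule sum.swap)
  also have "\<dots> = (background i a A * background i b B) $ j $ k"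
    by (simp add: fps_mult_nth fps_sum_nth background_nth)
  finally show "background i (a + b) (A \<star> B) $ j $ k = (background i a A * background i b B) $ j $ k" .
qed

lemma background_one: "background i 0 op_one = 1"
  by (intro fps_ext) (auto simp: background_nth op_one_def coeff_one fps_one_nth)

lemma background_pow:
  assumes "monic1 A"
  shows "background i (int n) (op_pow q A n) = background i 1 A ^ n"
proof (induction n)
  case (Suc n)
  then show ?case
    using background_mult[of A 1 "op_pow q A n" "int n"] monic1_pow(1)[OF assms] assms
    by (simp add: monic1_def)
qed (simp add: background_one)

end

context lax_setup
begin

text \<open>\<open>L\<close> becomes \<open>D^N (1 + (-1)^i t_i[0] D^(-i))\<close>, and the inner
  \<open>fps_X\<close> stands for \<open>D^(-1)\<close>.\<close>

lemma background_lax: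
  assumes "1 \<le> i" "i \<le> N"
  shows "background i (int N) (lax N) = twist ((- 1) ^ i * fps_X ^ i) (1 + fps_X)"
proof (intro fps_ext)
  fix j k
  have "(((- 1) ^ i * fps_X ^ i) :: complex fps) $ k = (if k = i then (- 1) ^ i else 0)"
    by (cases "even i") auto
  then have R: "twist ((- 1) ^ i * fps_X ^ i) (1 + fps_X) $ j $ k =
      (if j = 0 \<and> k = 0 then 1 else if j = 1 \<and> k = i then (- 1) ^ i else 0)"
    by (auto simp: twist_nth fps_one_nth)
  consider "k = 0" | "1 \<le> k" "k \<le> N" | "k > N" by linarith
  then show "background i (int N) (lax N) $ j $ k = twist ((- 1) ^ i * fps_X ^ i) (1 + fps_X) $ j $ k"
  proof cases
    case 1
    then show ?thesis unfolding R background_nth using assms by (simp add: lax_def coeff_one)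
  next
    case 2
    then have "lax N (int N - int k) = (- 1) ^ k * tgen k"
      by (simp add: lax_def nat_diff_distrib' flip: of_nat_diff)
    then show ?thesis
      unfolding R background_nth using 2 by (simp add: coeff_minus_one_power coeff_tgen_replicate)
  next
    case 3
    then show ?thesis unfolding R background_nth using assms by (simp add: lax_def)
  qed
qed

text \<open>The image of \<open>P\<close> and the twisted binomial series of exponent
  \<open>1/N\<close> are \<open>N\<close>-th roots of the same series, both with constant term
  1.\<close>

lemma background_P_pow:
  assumes "1 \<le> i" "i \<le> N"
  shows "background i (int n) (op_pow q P n) =
    twist ((- 1) ^ i * fps_X ^ i) (fps_binomial (of_nat n / of_nat N))"
proof -
  let ?v = "(- 1) ^ i * fps_X ^ i :: complex fps"
  have "background i 1 P ^ N = twist ?v (fps_binomial (1 / of_nat N) ^ N)"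
    using N2 unfolding background_pow[OF monic1_P, symmetric] P_pow_N background_lax[OF assms]
      fps_binomial_power by (simp add: fps_binomial_1)
  then have "background i 1 P = twist ?v (fps_binomial (1 / of_nat N))"
    unfolding twist_power using monic1_P
    by (rule_tac fps_power_inj[OF _ N1])
      (simp_all add: background_nth monic1_def coeff_one twist_nth)
  then show ?thesis
    unfolding background_pow[OF monic1_P] by (simp add: twist_power[symmetric] fps_binomial_power)
qed

text \<open>Up to sign the coefficient is \<open>n/N\<close> choose \<open>j\<close>, which is
  nonzero as \<open>n/N\<close> is not a natural number.\<close>

lemma coeff_P_pow_background:
  assumes "1 \<le> i" "i \<le> N" "\<not> N dvd n"
  shows "coeff (op_pow q P n (int n - int (i * j))) (replicate_mset j (i, 0)) \<noteq> 0"
proof -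
  have "(- 1 :: complex fps) = fps_const (- 1)" by (simp flip: fps_const_neg)
  then have "(((- 1) ^ i * fps_X ^ i) ^ j :: complex fps) = fps_const ((- 1) ^ (i * j)) * fps_X ^ (i * j)"
    by (simp add: power_mult power_mult_distrib)
  then have "coeff (op_pow q P n (int n - int (i * j))) (replicate_mset j (i, 0)) =
      (of_nat n / of_nat N gchoose j) * (- 1) ^ (i * j)"
    unfolding background_nth[symmetric] background_P_pow[OF assms(1,2)] by (simp add: twist_nth)
  moreover have "of_nat n / of_nat N gchoose j \<noteq> (0 :: complex)"
    by (rule gbinomial_nonzero) (rule fraction_not_nat[OF assms(3) N1])
  ultimately show ?thesis by simp
qed

lemma integ_Res_nonzero:
  assumes "\<not> N dvd n"
  shows "integ (op_Res (lax_frac_pow q N n)) \<noteq> 0"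
proof -
  have "coeff (op_pow q P n 0) (replicate_mset n (1, 0)) \<noteq> 0"
    using coeff_P_pow_background[of 1 n n] assms N1 by simp
  then have "coeff (integ (op_Res (lax_frac_pow q N n))) (replicate_mset n (1, 0)) \<noteq> 0"
    by (simp add: coeff_integ op_Res_def lax_frac_pow_def)
  then show ?thesis by (metis coeff_zero)
qed

section \<open>Nontriviality of the flows\<close>

text \<open>With \<open>n = N a + b\<close> and \<open>0 < b < N\<close>, only \<open>D\<^sup>N\<close> and \<open>\<plusminus>t\<^sub>N\<close> in \<open>L\<close> contribute to
  the coefficient of \<open>t\<^sub>N[0]\<^sup>a t\<^sub>N[1]\<close> in \<open>[L, P\<^sup>n\<^sub>+]\<^sub>b\<close>, and the \<open>D\<^sup>N\<close> terms vanish
  because \<open>b < N\<close>.\<close>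

definition tN_only :: "tseries \<Rightarrow> tseries" where
  "tN_only f = Abs_tseries (\<lambda>\<mu>. if \<forall>x\<in>#\<mu>. fst x = N then coeff f \<mu> else 0)"

lemma coeff_tN_only: "coeff (tN_only f) \<mu> = (if \<forall>x\<in>#\<mu>. fst x = N then coeff f \<mu> else 0)"
  by (simp add: tN_only_def)

text \<open>A monomial involves only variables \<open>t_N[m]\<close> exactly when both factors of
  any splitting do.\<close>

lemma tN_only_mult: "tN_only (f * g) = tN_only f * tN_only g"
proof (rule tseries_eqI)
  fix \<mu>
  let ?P = "\<lambda>\<mu> :: (nat \<times> int) multiset. \<forall>x\<in>#\<mu>. fst x = N"
  have P: "?P (fst p) \<and> ?P (snd p) \<longleftrightarrow> ?P \<mu>" if "p \<in> splits \<mu>" for p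
    using splitsD[OF that] by (metis union_iff)
  have if_sum: "(\<Sum>p\<in>S. if c then h p else 0) = (if c then sum h S else 0)"
    for c S and h :: "(nat \<times> int) multiset \<times> (nat \<times> int) multiset \<Rightarrow> complex"
    by simp
  have "coeff (tN_only f * tN_only g) \<mu> =
      (\<Sum>p \<in> splits \<mu>. if ?P \<mu> then coeff f (fst p) * coeff g (snd p) else 0)"
    unfolding coeff_times case_prod_unfold
    by (rule sum.cong[OF refl]) (unfold P[symmetric] coeff_tN_only, auto)
  then show "coeff (tN_only (f * g)) \<mu> = coeff (tN_only f * tN_only g) \<mu>"
    by (simp only: coeff_tN_only coeff_times[of f g] case_prod_unfold if_sum)
qed

lemma tN_only_simps:
  "tN_only 0 = 0" "tN_only 1 = 1" "tN_only (f + g) = tN_only f + tN_only g" "tN_only (- f) = - tN_only f"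
  "tN_only (f - g) = tN_only f - tN_only g" "tN_only (\<sigma> k f) = \<sigma> k (tN_only f)"
  by (rule tseries_eqI; auto simp: coeff_tN_only coeff_one)+

lemma tN_only_sum: "tN_only (sum f A) = (\<Sum>a\<in>A. tN_only (f a))"
  by (induction A rule: infinite_finite_induct) (simp_all add: tN_only_simps)

lemma tN_only_tgen: "tN_only (tgen k) = (if k = N then tgen N else 0)"
  by (rule tseries_eqI) (auto simp: coeff_tN_only coeff_tgen)

lemma tN_only_lax:
  "tN_only (lax N k) = (if k = int N then 1 else if k = 0 then (- 1) ^ N * tgen N else 0)"
proof -
  have "tN_only ((- 1) ^ l * tgen l) = (if l = N then (- 1) ^ N * tgen N else 0)" for l
    using minus_one_power_cases[of l] by (auto simp: tN_only_simps tN_only_tgen)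
  moreover have "N - nat k = N \<longleftrightarrow> k = 0" if "0 \<le> k" "k < int N"
    using that by auto
  ultimately show ?thesis using N1 by (auto simp: lax_def tN_only_simps)
qed

lemma lax_nonzeroD: "lax N k \<noteq> 0 \<Longrightarrow> 0 \<le> k \<and> k \<le> int N"
  by (auto simp: lax_def split: if_splits)

lemma tN_only_lax_comm:
  assumes A: "nonneg_op A" and b: "0 < b" "b < int N"
  shows "tN_only (\<lbrakk>lax N, A\<rbrakk> b) = (- 1) ^ N * (tN_only (A b) * (tgen N - \<sigma> b (tgen N)))"
proof -
  have A0: "A k = 0" if "k < 0" for k using A that by (simp add: nonneg_op_def)
  have 1: "(lax N \<star> A) b = (\<Sum>k\<in>{0..int N}. lax N k * \<sigma> k (A (b - k)))"
    by (rule op_mult_eq_sum) (use lax_nonzeroD in auto)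
  have 2: "(A \<star> lax N) b = (\<Sum>k\<in>{0..b}. A k * \<sigma> k (lax N (b - k)))"
  proof (rule op_mult_eq_sum)
    show "k \<in> {0..b}" if "A k \<noteq> 0" "lax N (b - k) \<noteq> 0" for k
      using that A0[of k] lax_nonzeroD[of "b - k"] by force
  qed simp
  \<comment> \<open>Indices strictly between 0 and \<open>N\<close> are killed by
    \<open>tN_only\<close>, and \<open>k = N\<close> meets a coefficient of \<open>A\<close> of
    negative degree.\<close>
  have "tN_only ((lax N \<star> A) b) = (\<Sum>k\<in>{0..int N}. if k = 0 then (- 1) ^ N * tgen N * tN_only (A b) else 0)"
    unfolding 1 tN_only_sum
    by (rule sum.cong) (use b in \<open>auto simp: tN_only_mult tN_only_simps tN_only_lax A0\<close>)
  moreover have "tN_only ((A \<star> lax N) b) =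
      (\<Sum>k\<in>{0..b}. if k = b then tN_only (A b) * \<sigma> b ((- 1) ^ N * tgen N) else 0)"
    unfolding 2 tN_only_sum
    by (rule sum.cong) (use b in \<open>auto simp: tN_only_mult tN_only_simps tN_only_lax A0\<close>)
  moreover have "\<sigma> b ((- 1) ^ N * tgen N) = (- 1) ^ N * \<sigma> b (tgen N)"
    using minus_one_power_cases[of N] by (auto simp: shift_uminus)
  ultimately show ?thesis
    using b by (simp add: op_comm_def tN_only_simps algebra_simps)
qed

lemma flow_nontrivial:
  assumes "\<not> N dvd n"
  shows "\<exists>f \<in> Rq q N. flow q N n f \<noteq> 0"
proof
  define a b where "a = n div N" and "b = n mod N"
  have b: "0 < b" "b < N" and n: "n = N * a + b"
    using assms N1 by (auto simp: a_def b_def mod_greater_zero_iff_not_dvd)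
  let ?A = "Ppos n" and ?u = "tgen N - \<sigma> (int b) (tgen N)"
  \<comment> \<open>One mode of nonzero weight is needed, because \<open>t_N[0]\<close> cancels in
    \<open>?u\<close>; the mode 1 has coefficient \<open>1 - q^(-b)\<close> there.\<close>
  let ?\<mu> = "add_mset (N, 1) (replicate_mset a (N, 0 :: int))"
  have "coeff (op_pow q P n (int n - int (N * a))) (replicate_mset a (N, 0)) \<noteq> 0"
    using coeff_P_pow_background[of N n a] assms N1 by simp
  then have c: "coeff (?A (int b)) (replicate_mset a (N, 0)) \<noteq> 0"
    by (simp add: n op_plus_part_def)
  have u: "coeff ?u \<beta> = (if \<exists>m. \<beta> = {#(N, m)#} then 1 - q powi (- int b * weight \<beta>) else 0)" for \<beta>
    by (auto simp: coeff_tgen)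
  \<comment> \<open>In a contributing splitting the second factor is a single \<open>t_N[m]\<close>
    dividing \<open>?\<mu>\<close>, and \<open>m = 0\<close> is excluded by that
    cancellation.\<close>
  have "coeff (tN_only (?A (int b)) * ?u) ?\<mu> =
      (\<Sum>p \<in> {(replicate_mset a (N, 0), {#(N, 1)#})}. coeff (tN_only (?A (int b))) (fst p) * coeff ?u (snd p))"
    unfolding coeff_times case_prod_unfold
  proof (rule sum.mono_neutral_right)
    show "\<forall>p \<in> splits ?\<mu> - {(replicate_mset a (N, 0), {#(N, 1)#})}.
        coeff (tN_only (?A (int b))) (fst p) * coeff ?u (snd p) = 0"
    proof
      fix p assume p: "p \<in> splits ?\<mu> - {(replicate_mset a (N, 0), {#(N, 1)#})}"
      obtain \<alpha> \<beta> where [simp]: "p = (\<alpha>, \<beta>)" by (cases p)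
      have s: "(\<alpha>, \<beta>) \<in> splits ?\<mu>"
        and ne: "(\<alpha>, \<beta>) \<noteq> (replicate_mset a (N, 0), {#(N, 1)#})"
        using p by auto
      have "coeff ?u \<beta> = 0"
      proof (cases "\<exists>m. \<beta> = {#(N, m)#}")
        case True
        then obtain m where m: "\<beta> = {#(N, m)#}" by blast
        have eq: "\<alpha> + \<beta> = ?\<mu>" using s by (simp add: splits_def)
        then have "(N, m) \<in># ?\<mu>" by (simp add: m flip: eq)
        then have "m = 0 \<or> m = 1" by (auto split: if_splits)
        moreover have "m \<noteq> 1" using eq ne m by auto
        ultimately show ?thesis unfolding u using m by simp
      qed (unfold u, simp)
      then show "coeff (tN_only (?A (int b))) (fst p) * coeff ?u (snd p) = 0"
        by (simp only: \<open>p = (\<alpha>, \<beta>)\<close> snd_conv mult_zero_right)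
    qed
  qed (simp, simp add: splits_def)
  also have "\<dots> = coeff (?A (int b)) (replicate_mset a (N, 0)) * (1 - q powi (- int b))"
    unfolding u by (simp add: coeff_tN_only)
  also have "\<dots> \<noteq> 0"
    using c powi_ne_1[OF q_nz nonroot, of "- int b"] b by simp
  finally have "coeff (tN_only (?A (int b)) * ?u) ?\<mu> \<noteq> 0" .
  moreover have "tN_only (\<lbrakk>lax N, ?A\<rbrakk> (int b)) = (- 1) ^ N * (tN_only (?A (int b)) * ?u)"
    by (rule tN_only_lax_comm[OF nonneg_plus_part]) (use b in simp_all)
  ultimately have "coeff (tN_only (\<lbrakk>lax N, ?A\<rbrakk> (int b))) ?\<mu> \<noteq> 0"
    by (simp only: coeff_minus_one_power) simp
  then have "\<lbrakk>lax N, ?A\<rbrakk> (int b) \<noteq> 0" by (auto simp: tN_only_simps)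
  then show "flow q N n (lax N (int b)) \<noteq> 0"
    using fun_cong[OF E_lax, of n "int b"] by (simp add: flow_eq Rq_lax)
  show "lax N (int b) \<in> Rq q N" by (rule Rq_lax)
qed

end

theorem proposition1:
  fixes q :: complex and N :: nat
  assumes "q \<noteq> 0" and "\<forall>k\<ge>1. q ^ k \<noteq> 1" and "N \<ge> 2"
  shows "(\<forall>n\<ge>1. \<not> N dvd n \<longrightarrow> (\<exists>f \<in> Rq q N. flow q N n f \<noteq> 0)) \<and>
         (\<forall>n\<ge>1. \<forall>m\<ge>1. \<forall>f \<in> Rq q N. flow q N n (flow q N m f) = flow q N m (flow q N n f)) \<and>
         (\<forall>n\<ge>1. \<forall>m\<ge>1. act q N (flow q N m) (integ (op_Res (lax_frac_pow q N n))) = 0) \<and>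
         (\<forall>n\<ge>1. \<not> N dvd n \<longrightarrow> integ (op_Res (lax_frac_pow q N n)) \<noteq> 0)"
proof -
  interpret lax_setup q N by unfold_locales (use assms in auto)
  \<comment> \<open>\<open>E_Rq\<close> keeps iterated flows inside the ring, where each flow equals
    \<open>E n\<close>.\<close>
  show ?thesis
    using flow_nontrivial Res_conserved integ_Res_nonzero by (simp add: flow_eq E_Rq E_commute)
qed

end
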